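(* Let $\mu$ be a regular cardinal and let $\mathcal{K}$ be an accessible category with $\mu$-directed colimits all of whose morphisms are monomorphisms. Then there is a universal $\mu$-AEC $\mathcal{L}$ and an essentially surjective faithful functor $F:\mathcal{L}\to\mathcal{K}$ preserving $\mu$-directed colimits.
   Context: A category is $\lambda$-accessible if it has $\lambda$-directed colimits and a set $S$ of $\lambda$-presentable objects (objects whose hom-functor preserves $\lambda$-directed colimits) such that every object is a $\lambda$-directed colimit of objects in $S$; it is accessible if it is $\lambda$-accessible for some regular $\lambda$. A universal $\mu$-AEC is a class of structures in a fixed vocabulary whose symbols have arity $<\mu$, closed under isomorphism, substructures, and unions of $\mu$-directed systems of substructure inclusions, viewed as a category whose morphisms are substructure embeddings (isomorphisms onto a substructure). A functor is essentially surjective if every object of its codomain is isomorphic to an object in its image. *)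

theory Defs
  imports Main "HOL-Library.FuncSet"
begin

unbundle cardinal_syntax

text \<open>
  Size convention. A type \<open>'u\<close> plays the role of the universe: \<open>small\<close> means of cardinality less
  than that of \<open>'u\<close>, and small sets are the "sets" of the informal text, arbitrary sets (of any type)
  are its "classes". Every small set has a copy among the subsets of \<open>'u\<close>, so cardinals,
  index posets, vocabularies and underlying sets of structures are taken inside \<open>'u\<close> without loss.
  The cardinality of \<open>'u\<close> is only required to be regular, that is, small unions of small sets are
  small; a Grothendieck universe is the case where it is strongly inaccessible.
\<close>

definition regular_universe :: "'u itself \<Rightarrow> bool" where
  "regular_universe _ \<longleftrightarrow> infinite (UNIV :: 'u set) \<and> regularCard |UNIV :: 'u set|"

definition small :: "'u itself \<Rightarrow> 'a set \<Rightarrow> bool" where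
  "small _ A \<longleftrightarrow> |A| <o |UNIV :: 'u set|"

definition regular_cardinal :: "'u rel \<Rightarrow> bool" where
  "regular_cardinal \<mu> \<longleftrightarrow> Card_order \<mu> \<and> cinfinite \<mu> \<and> regularCard \<mu> \<and> \<mu> <o |UNIV :: 'u set|"


section \<open>Categories and functors\<close>

record ('o, 'm) cat =
  Obj :: "'o set"
  Arr :: "'m set"
  src :: "'m \<Rightarrow> 'o"
  trg :: "'m \<Rightarrow> 'o"
  idt :: "'o \<Rightarrow> 'm"
  cmp :: "'m \<Rightarrow> 'm \<Rightarrow> 'm"  \<comment> \<open>\<open>cmp C g f\<close> is \<open>g\<close> after \<open>f\<close>\<close>

definition hom :: "('o, 'm) cat \<Rightarrow> 'o \<Rightarrow> 'o \<Rightarrow> 'm set" where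
  "hom C X Y = {f \<in> Arr C. src C f = X \<and> trg C f = Y}"

locale category =
  fixes C :: "('o, 'm) cat"
  assumes src_Obj: "f \<in> Arr C \<Longrightarrow> src C f \<in> Obj C"
    and trg_Obj: "f \<in> Arr C \<Longrightarrow> trg C f \<in> Obj C"
    and idt_hom: "X \<in> Obj C \<Longrightarrow> idt C X \<in> hom C X X"
    and cmp_hom: "f \<in> hom C X Y \<Longrightarrow> g \<in> hom C Y Z \<Longrightarrow> cmp C g f \<in> hom C X Z"
    and cmp_idt_right: "f \<in> hom C X Y \<Longrightarrow> cmp C f (idt C X) = f"
    and cmp_idt_left: "f \<in> hom C X Y \<Longrightarrow> cmp C (idt C Y) f = f"
    and cmp_assoc: "f \<in> hom C W X \<Longrightarrow> g \<in> hom C X Y \<Longrightarrow> h \<in> hom C Y Z \<Longrightarrow>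
      cmp C h (cmp C g f) = cmp C (cmp C h g) f"

definition monomorphism :: "('o, 'm) cat \<Rightarrow> 'm \<Rightarrow> bool" where
  "monomorphism C f \<longleftrightarrow> f \<in> Arr C \<and>
    (\<forall>W. \<forall>g \<in> hom C W (src C f). \<forall>h \<in> hom C W (src C f). cmp C f g = cmp C f h \<longrightarrow> g = h)"

definition isomorphic :: "('o, 'm) cat \<Rightarrow> 'o \<Rightarrow> 'o \<Rightarrow> bool" where
  "isomorphic C X Y \<longleftrightarrow> X \<in> Obj C \<and> Y \<in> Obj C \<and>
    (\<exists>f \<in> hom C X Y. \<exists>g \<in> hom C Y X. cmp C g f = idt C X \<and> cmp C f g = idt C Y)"

definition locally_small :: "'u itself \<Rightarrow> ('o, 'm) cat \<Rightarrow> bool" where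
  "locally_small U C \<longleftrightarrow> (\<forall>X \<in> Obj C. \<forall>Y \<in> Obj C. small U (hom C X Y))"

record ('o1, 'm1, 'o2, 'm2) fnctr =
  omap :: "'o1 \<Rightarrow> 'o2"
  amap :: "'m1 \<Rightarrow> 'm2"

locale is_functor =
  C: category C + D: category D
  for C :: "('o1, 'm1) cat" and D :: "('o2, 'm2) cat" +
  fixes F :: "('o1, 'm1, 'o2, 'm2) fnctr"
  assumes omap_Obj: "X \<in> Obj C \<Longrightarrow> omap F X \<in> Obj D"
    and amap_hom: "f \<in> hom C X Y \<Longrightarrow> amap F f \<in> hom D (omap F X) (omap F Y)"
    and amap_idt: "X \<in> Obj C \<Longrightarrow> amap F (idt C X) = idt D (omap F X)"
    and amap_cmp: "f \<in> hom C X Y \<Longrightarrow> g \<in> hom C Y Z \<Longrightarrow>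
      amap F (cmp C g f) = cmp D (amap F g) (amap F f)"

definition functor_comp ::
    "('o2, 'm2, 'o3, 'm3) fnctr \<Rightarrow> ('o1, 'm1, 'o2, 'm2) fnctr \<Rightarrow> ('o1, 'm1, 'o3, 'm3) fnctr" where
  "functor_comp G F = \<lparr>omap = omap G \<circ> omap F, amap = amap G \<circ> amap F\<rparr>"

definition faithful ::
    "('o1, 'm1) cat \<Rightarrow> ('o1, 'm1, 'o2, 'm2) fnctr \<Rightarrow> bool" where
  "faithful C F \<longleftrightarrow> (\<forall>X \<in> Obj C. \<forall>Y \<in> Obj C. inj_on (amap F) (hom C X Y))"

definition essentially_surjective ::
    "('o1, 'm1) cat \<Rightarrow> ('o2, 'm2) cat \<Rightarrow> ('o1, 'm1, 'o2, 'm2) fnctr \<Rightarrow> bool" where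
  "essentially_surjective C D F \<longleftrightarrow> (\<forall>Y \<in> Obj D. \<exists>X \<in> Obj C. isomorphic D (omap F X) Y)"


section \<open>Directed colimits\<close>

definition is_cocone ::
    "('i, 'j) cat \<Rightarrow> ('o, 'm) cat \<Rightarrow> ('i, 'j, 'o, 'm) fnctr \<Rightarrow> 'o \<Rightarrow> ('i \<Rightarrow> 'm) \<Rightarrow> bool" where
  "is_cocone J C G X c \<longleftrightarrow> X \<in> Obj C \<and>
    (\<forall>i \<in> Obj J. c i \<in> hom C (omap G i) X) \<and>
    (\<forall>i j. \<forall>e \<in> hom J i j. cmp C (c j) (amap G e) = c i)"

definition is_colimit ::
    "('i, 'j) cat \<Rightarrow> ('o, 'm) cat \<Rightarrow> ('i, 'j, 'o, 'm) fnctr \<Rightarrow> 'o \<Rightarrow> ('i \<Rightarrow> 'm) \<Rightarrow> bool" where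
  "is_colimit J C G X c \<longleftrightarrow> is_cocone J C G X c \<and>
    (\<forall>Y d. is_cocone J C G Y d \<longrightarrow>
      (\<exists>!h. h \<in> hom C X Y \<and> (\<forall>i \<in> Obj J. cmp C h (c i) = d i)))"

text \<open>The bound over the empty subset makes a \<open>\<mu>\<close>-directed poset nonempty.\<close>

definition directed_poset :: "'u rel \<Rightarrow> 'u set \<Rightarrow> 'u rel \<Rightarrow> bool" where
  "directed_poset \<mu> I r \<longleftrightarrow> small TYPE('u) I \<and> partial_order_on I r \<and>
    (\<forall>X \<subseteq> I. |X| <o \<mu> \<longrightarrow> (\<exists>b \<in> I. \<forall>x \<in> X. (x, b) \<in> r))"

definition poset_cat :: "'i set \<Rightarrow> 'i rel \<Rightarrow> ('i, 'i \<times> 'i) cat" where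
  "poset_cat I r = \<lparr>Obj = I, Arr = r, src = fst, trg = snd, idt = (\<lambda>i. (i, i)),
    cmp = (\<lambda>g f. (fst f, snd g))\<rparr>"

definition has_directed_colimits :: "'u rel \<Rightarrow> ('o, 'm) cat \<Rightarrow> bool" where
  "has_directed_colimits \<mu> C \<longleftrightarrow>
    (\<forall>I r G. directed_poset \<mu> I r \<longrightarrow> is_functor (poset_cat I r) C G \<longrightarrow>
      (\<exists>X c. is_colimit (poset_cat I r) C G X c))"

definition preserves_directed_colimits ::
    "'u rel \<Rightarrow> ('o1, 'm1) cat \<Rightarrow> ('o2, 'm2) cat \<Rightarrow> ('o1, 'm1, 'o2, 'm2) fnctr \<Rightarrow> bool" where
  "preserves_directed_colimits \<mu> C D F \<longleftrightarrow>
    (\<forall>I r G X c. directed_poset \<mu> I r \<longrightarrow> is_functor (poset_cat I r) C G \<longrightarrow>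
      is_colimit (poset_cat I r) C G X c \<longrightarrow>
      is_colimit (poset_cat I r) D (functor_comp F G) (omap F X) (\<lambda>i. amap F (c i)))"


section \<open>Accessible categories\<close>

definition set_cat :: "'u itself \<Rightarrow> ('a set, 'a set \<times> ('a \<Rightarrow> 'a) \<times> 'a set) cat" where
  "set_cat U = \<lparr>Obj = {A. small U A},
    Arr = {(A, f, B). small U A \<and> small U B \<and> f \<in> A \<rightarrow>\<^sub>E B},
    src = (\<lambda>(A, f, B). A), trg = (\<lambda>(A, f, B). B),
    idt = (\<lambda>A. (A, \<lambda>x\<in>A. x, A)),
    cmp = (\<lambda>(B, g, D) (A, f, B'). (A, compose A g f, D))\<rparr>"

text \<open>
  The covariant hom-functor. Its values are sets of elements of \<open>'m + 'u\<close>: the arrows are tagged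
  by \<open>Inl\<close>, and the summand \<open>'u\<close> only serves to make the target category contain a copy of
  every small set, whatever the type \<open>'m\<close> of arrows is.
\<close>

definition hom_functor :: "('o, 'm) cat \<Rightarrow> 'o \<Rightarrow>
    ('o, 'm, ('m + 'u) set, ('m + 'u) set \<times> ('m + 'u \<Rightarrow> 'm + 'u) \<times> ('m + 'u) set) fnctr" where
  "hom_functor C X = \<lparr>omap = (\<lambda>Y. Inl ` hom C X Y),
    amap = (\<lambda>f. (Inl ` hom C X (src C f),
                 \<lambda>z \<in> Inl ` hom C X (src C f). Inl (cmp C f (projl z)),
                 Inl ` hom C X (trg C f)))\<rparr>"

definition presentable :: "'u rel \<Rightarrow> ('o, 'm) cat \<Rightarrow> 'o \<Rightarrow> bool" where
  "presentable \<mu> C X \<longleftrightarrow> X \<in> Obj C \<and>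
    preserves_directed_colimits \<mu> C (set_cat TYPE('u))
      (hom_functor C X ::
        (_, _, ('m + 'u) set, ('m + 'u) set \<times> ('m + 'u \<Rightarrow> 'm + 'u) \<times> ('m + 'u) set) fnctr)"

definition directed_colimit_of :: "'u rel \<Rightarrow> ('o, 'm) cat \<Rightarrow> 'o set \<Rightarrow> 'o \<Rightarrow> bool" where
  "directed_colimit_of \<mu> C S X \<longleftrightarrow>
    (\<exists>I r G c. directed_poset \<mu> I r \<and> is_functor (poset_cat I r) C G \<and>
      (\<forall>i \<in> I. omap G i \<in> S) \<and> is_colimit (poset_cat I r) C G X c)"

text \<open>Local smallness is the usual convention without which the hom-functors above do not exist.\<close>

definition accessible_at :: "'u rel \<Rightarrow> ('o, 'm) cat \<Rightarrow> bool" where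
  "accessible_at \<mu> C \<longleftrightarrow> category C \<and> locally_small TYPE('u) C \<and> has_directed_colimits \<mu> C \<and>
    (\<exists>S. small TYPE('u) S \<and> (\<forall>X \<in> S. presentable \<mu> C X) \<and>
      (\<forall>X \<in> Obj C. directed_colimit_of \<mu> C S X))"

definition accessible :: "'u itself \<Rightarrow> ('o, 'm) cat \<Rightarrow> bool" where
  "accessible _ C \<longleftrightarrow> (\<exists>\<mu> :: 'u rel. regular_cardinal \<mu> \<and> accessible_at \<mu> C)"


section \<open>Universal \<open>\<mu>\<close>-AECs\<close>

text \<open>
  The arity of a symbol is an index set for its arguments, so that an argument tuple from \<open>A\<close> is an
  element of \<open>arity \<rightarrow>\<^sub>E A\<close>.
\<close>

record 'u vocabulary =
  funs :: "'u set"
  rels :: "'u set"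
  fun_arity :: "'u \<Rightarrow> 'u set"
  rel_arity :: "'u \<Rightarrow> 'u set"

definition is_vocabulary :: "'u rel \<Rightarrow> 'u vocabulary \<Rightarrow> bool" where
  "is_vocabulary \<mu> \<tau> \<longleftrightarrow> small TYPE('u) (funs \<tau>) \<and> small TYPE('u) (rels \<tau>) \<and>
    (\<forall>f \<in> funs \<tau>. |fun_arity \<tau> f| <o \<mu>) \<and> (\<forall>R \<in> rels \<tau>. |rel_arity \<tau> R| <o \<mu>)"

record 'u struct =
  carrier :: "'u set"
  fun_interp :: "'u \<Rightarrow> ('u \<Rightarrow> 'u) \<Rightarrow> 'u"
  rel_interp :: "'u \<Rightarrow> ('u \<Rightarrow> 'u) set"

text \<open>
  Interpretations are fixed outside the vocabulary, so that equality of structures is equality of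
  carriers and interpretations. The empty structure is allowed (if there are no constants).
\<close>

definition is_struct :: "'u vocabulary \<Rightarrow> 'u struct \<Rightarrow> bool" where
  "is_struct \<tau> M \<longleftrightarrow> small TYPE('u) (carrier M) \<and>
    fun_interp M \<in> (\<Pi>\<^sub>E f \<in> funs \<tau>. (fun_arity \<tau> f \<rightarrow>\<^sub>E carrier M) \<rightarrow>\<^sub>E carrier M) \<and>
    (\<forall>R \<in> rels \<tau>. rel_interp M R \<subseteq> rel_arity \<tau> R \<rightarrow>\<^sub>E carrier M) \<and>
    (\<forall>R. R \<notin> rels \<tau> \<longrightarrow> rel_interp M R = {})"

definition substructure :: "'u vocabulary \<Rightarrow> 'u struct \<Rightarrow> 'u struct \<Rightarrow> bool" where
  "substructure \<tau> M N \<longleftrightarrow> is_struct \<tau> M \<and> is_struct \<tau> N \<and> carrier M \<subseteq> carrier N \<and>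
    (\<forall>f \<in> funs \<tau>. \<forall>t \<in> fun_arity \<tau> f \<rightarrow>\<^sub>E carrier M. fun_interp M f t = fun_interp N f t) \<and>
    (\<forall>R \<in> rels \<tau>. rel_interp M R = rel_interp N R \<inter> (rel_arity \<tau> R \<rightarrow>\<^sub>E carrier M))"

definition struct_iso :: "'u vocabulary \<Rightarrow> ('u \<Rightarrow> 'u) \<Rightarrow> 'u struct \<Rightarrow> 'u struct \<Rightarrow> bool" where
  "struct_iso \<tau> h M N \<longleftrightarrow> is_struct \<tau> M \<and> is_struct \<tau> N \<and>
    h \<in> extensional (carrier M) \<and> bij_betw h (carrier M) (carrier N) \<and>
    (\<forall>f \<in> funs \<tau>. \<forall>t \<in> fun_arity \<tau> f \<rightarrow>\<^sub>E carrier M.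
      h (fun_interp M f t) = fun_interp N f (compose (fun_arity \<tau> f) h t)) \<and>
    (\<forall>R \<in> rels \<tau>. \<forall>t \<in> rel_arity \<tau> R \<rightarrow>\<^sub>E carrier M.
      t \<in> rel_interp M R \<longleftrightarrow> compose (rel_arity \<tau> R) h t \<in> rel_interp N R)"

definition embedding :: "'u vocabulary \<Rightarrow> ('u \<Rightarrow> 'u) \<Rightarrow> 'u struct \<Rightarrow> 'u struct \<Rightarrow> bool" where
  "embedding \<tau> h M N \<longleftrightarrow> (\<exists>N'. substructure \<tau> N' N \<and> struct_iso \<tau> h M N')"

text \<open>
  The union of a \<open>\<mu>\<close>-directed system of substructure inclusions: every argument tuple, having fewer
  than \<open>\<mu>\<close> entries, lies in some member, and all members containing it give the same value.
\<close>

definition struct_union :: "'u vocabulary \<Rightarrow> 'u set \<Rightarrow> ('u \<Rightarrow> 'u struct) \<Rightarrow> 'u struct" where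
  "struct_union \<tau> I M = \<lparr>carrier = (\<Union>i\<in>I. carrier (M i)),
    fun_interp = (\<lambda>f\<in>funs \<tau>. \<lambda>t \<in> fun_arity \<tau> f \<rightarrow>\<^sub>E (\<Union>i\<in>I. carrier (M i)).
      fun_interp (M (SOME i. i \<in> I \<and> t \<in> fun_arity \<tau> f \<rightarrow>\<^sub>E carrier (M i))) f t),
    rel_interp = (\<lambda>R. \<Union>i\<in>I. rel_interp (M i) R)\<rparr>"

definition universal_AEC :: "'u rel \<Rightarrow> 'u vocabulary \<Rightarrow> 'u struct set \<Rightarrow> bool" where
  "universal_AEC \<mu> \<tau> L \<longleftrightarrow> is_vocabulary \<mu> \<tau> \<and>
    (\<forall>M \<in> L. is_struct \<tau> M) \<and>
    (\<forall>M \<in> L. \<forall>N h. struct_iso \<tau> h M N \<longrightarrow> N \<in> L) \<and>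
    (\<forall>N \<in> L. \<forall>M. substructure \<tau> M N \<longrightarrow> M \<in> L) \<and>
    (\<forall>I r M. directed_poset \<mu> I r \<longrightarrow> (\<forall>i \<in> I. M i \<in> L) \<longrightarrow>
      (\<forall>(i, j) \<in> r. substructure \<tau> (M i) (M j)) \<longrightarrow> struct_union \<tau> I M \<in> L)"

definition AEC_cat :: "'u vocabulary \<Rightarrow> 'u struct set \<Rightarrow>
    ('u struct, 'u struct \<times> ('u \<Rightarrow> 'u) \<times> 'u struct) cat" where
  "AEC_cat \<tau> L = \<lparr>Obj = L,
    Arr = {(M, h, N). M \<in> L \<and> N \<in> L \<and> embedding \<tau> h M N},
    src = (\<lambda>(M, h, N). M), trg = (\<lambda>(M, h, N). N),
    idt = (\<lambda>M. (M, \<lambda>x\<in>carrier M. x, M)),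
    cmp = (\<lambda>(N, g, P) (M, f, N'). (M, compose (carrier M) g f, P))\<rparr>"

end

theory Submission
  imports Defs
begin

text \<open>
  Let \<open>\<kappa>\<close> be an index of accessibility of \<open>K\<close>, and \<open>\<nu>\<close> the smaller of \<open>\<kappa>\<close> and \<open>\<mu>\<close>. Then \<open>K\<close> has
  \<open>\<nu>\<close>-directed colimits, every object is a \<open>\<nu>\<close>-directed colimit of objects of a small set \<open>S\<close>, and
  since a \<open>\<mu>\<close>-directed poset is \<open>\<nu>\<close>-directed, a universal \<open>\<nu>\<close>-AEC is a universal \<open>\<mu>\<close>-AEC. So no index
  of accessibility has to be raised.

  The structures of the class are \<open>\<nu>\<close>-directed posets together with a diagram of that shape in \<open>S\<close>:
  a binary relation for each arrow of \<open>S\<close> records the edges, and Skolem functions of arity below \<open>\<nu>\<close>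
  choose upper bounds, which makes the class closed under substructures. The functor takes such a
  diagram to its colimit. As arrows are monic, two elements \<open>x\<close>, \<open>y\<close> of the same sort have the same
  colimit leg iff their edges to a common upper bound \<open>z\<close> carry the same arrow. Forbidding this for
  \<open>x \<noteq> y\<close> is a universal condition and makes the functor faithful. Essential surjectivity survives
  it: given a diagram with colimit \<open>X\<close>, choose one index for each subobject of \<open>X\<close> that occurs as a
  leg, and order these indices by factorization.
\<close>

section \<open>Cardinals and preorders\<close>

lemma small_UNION:
  assumes "regular_universe TYPE('u)" "small TYPE('u) I" "\<And>i. i \<in> I \<Longrightarrow> small TYPE('u) (A i)"
  shows "small TYPE('u) (\<Union>i\<in>I. A i)"
  using assms regularCard_UNION_bound[of "|UNIV :: 'u set|" I A]
  by (simp add: regular_universe_def small_def cinfinite_def card_of_card_order_on Field_card_of)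

lemma small_subset: "small TYPE('u) B \<Longrightarrow> A \<subseteq> B \<Longrightarrow> small TYPE('u) A"
  unfolding small_def using card_of_mono1 ordLeq_ordLess_trans by blast

lemma card_of_image_ordLess: "|A| <o r \<Longrightarrow> |f ` A| <o r"
  using card_of_image ordLeq_ordLess_trans by blast

lemma regular_cardinal_Card_order: "regular_cardinal \<nu> \<Longrightarrow> Card_order \<nu>"
  by (simp add: regular_cardinal_def)

lemma finite_ordLess_regular_cardinal: "regular_cardinal \<nu> \<Longrightarrow> finite X \<Longrightarrow> |X| <o \<nu>"
  unfolding regular_cardinal_def
  by (intro Cfinite_ordLess_Cinfinite) (auto simp: cfinite_def card_of_card_order_on Field_card_of)

lemma ordLess_bij_betw_underS:
  assumes "Well_order \<nu>" "|X| <o \<nu>"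
  obtains \<alpha> f where "\<alpha> \<in> Field \<nu>" "bij_betw f (underS \<nu> \<alpha>) X"
proof -
  obtain \<alpha> where \<alpha>: "\<alpha> \<in> Field \<nu>" "|X| =o Restr \<nu> (underS \<nu> \<alpha>)"
    using assms ordLess_iff_ordIso_Restr card_of_Well_order by blast
  have "Field (Restr \<nu> (underS \<nu> \<alpha>)) = underS \<nu> \<alpha>"
    using assms(1) by (intro Refl_Field_Restr2) (auto simp: order_on_defs underS_def Field_def)
  moreover obtain g where "iso ( |X| ) (Restr \<nu> (underS \<nu> \<alpha>)) g"
    using \<alpha>(2) by (auto simp: ordIso_def)
  ultimately have "bij_betw g X (underS \<nu> \<alpha>)"
    by (simp add: iso_def Field_card_of)
  then show ?thesis using that[OF \<alpha>(1)] bij_betw_inv_into by blast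
qed

lemma preorder_on_skeleton:
  assumes "preorder_on I r"
  obtains J where "J \<subseteq> I" "antisym (Restr r J)" "\<And>i. i \<in> I \<Longrightarrow> \<exists>j\<in>J. (i, j) \<in> r \<and> (j, i) \<in> r"
proof -
  define e where "e = r \<inter> r\<inverse>"
  have e: "equiv I e"
    using assms unfolding preorder_on_def e_def equiv_def refl_on_def sym_def trans_def by blast
  define rep where "rep i = (SOME j. j \<in> e `` {i})" for i
  have rep: "(i, rep i) \<in> e" if "i \<in> I" for i
    using equiv_class_self[OF e that] someI[of "\<lambda>j. j \<in> e `` {i}" i] by (simp add: rep_def)
  have rep_cong: "rep i = rep j" if "(i, j) \<in> e" for i j
    using equiv_class_eq[OF e that] by (simp add: rep_def)
  show ?thesis
  proof
    show "rep ` I \<subseteq> I" using rep e by (auto simp: equiv_def refl_on_def)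
    show "antisym (Restr r (rep ` I))"
    proof (rule antisymI)
      fix a b assume "(a, b) \<in> Restr r (rep ` I)" "(b, a) \<in> Restr r (rep ` I)"
      then obtain i j where ij: "i \<in> I" "j \<in> I" "a = rep i" "b = rep j" and "(a, b) \<in> e"
        by (auto simp: e_def)
      moreover have "rep a = a" "rep b = b" using rep_cong[OF rep] ij by simp_all
      ultimately show "a = b" using rep_cong by metis
    qed
    show "\<exists>j\<in>rep ` I. (i, j) \<in> r \<and> (j, i) \<in> r" if "i \<in> I" for i
      using rep[OF that] that by (auto simp: e_def)
  qed
qed


section \<open>Directed posets\<close>

lemma directed_poset_small: "directed_poset \<mu> I r \<Longrightarrow> small TYPE('u) (I :: 'u set)"
  by (simp add: directed_poset_def)

lemma directed_poset_partial_order: "directed_poset \<mu> I r \<Longrightarrow> partial_order_on I r"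
  by (simp add: directed_poset_def)

lemma directed_poset_bound:
  assumes "directed_poset \<mu> I r" "X \<subseteq> I" "|X| <o \<mu>"
  obtains b where "b \<in> I" "\<And>x. x \<in> X \<Longrightarrow> (x, b) \<in> r"
  using assms by (auto simp: directed_poset_def)

lemma directed_poset_bound_pair:
  assumes "regular_cardinal \<mu>" "directed_poset \<mu> I r" "i \<in> I" "j \<in> I"
  obtains k where "k \<in> I" "(i, k) \<in> r" "(j, k) \<in> r"
proof -
  have "|{i, j}| <o \<mu>" by (rule finite_ordLess_regular_cardinal[OF assms(1)]) simp
  then obtain k where "k \<in> I" "\<And>x. x \<in> {i, j} \<Longrightarrow> (x, k) \<in> r"
    using directed_poset_bound[OF assms(2), of "{i, j}"] assms(3,4) by blast
  then show ?thesis using that by blast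
qed

lemma directed_poset_mono:
  assumes "directed_poset \<mu> I r" "\<nu> \<le>o \<mu>"
  shows "directed_poset \<nu> I r"
  using assms ordLess_ordLeq_trans unfolding directed_poset_def by blast

lemma directed_UN_subset:
  assumes dir: "directed_poset \<mu> I r" and mono: "\<And>i j. (i, j) \<in> r \<Longrightarrow> B i \<subseteq> B j"
    and A: "A \<subseteq> (\<Union>i\<in>I. B i)" "|A| <o \<mu>"
  obtains i where "i \<in> I" "A \<subseteq> B i"
proof -
  have "\<forall>x\<in>A. \<exists>i. i \<in> I \<and> x \<in> B i" using A(1) by blast
  then obtain \<iota> where \<iota>: "\<And>x. x \<in> A \<Longrightarrow> \<iota> x \<in> I \<and> x \<in> B (\<iota> x)" by metis
  have "\<iota> ` A \<subseteq> I" "|\<iota> ` A| <o \<mu>" using \<iota> A(2) by (auto intro: card_of_image_ordLess)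
  then obtain i where i: "i \<in> I" "\<And>j. j \<in> \<iota> ` A \<Longrightarrow> (j, i) \<in> r"
    using directed_poset_bound[OF dir, of "\<iota> ` A"] by metis
  have "A \<subseteq> B i"
  proof
    fix x assume x: "x \<in> A"
    then have "B (\<iota> x) \<subseteq> B i" using i(2) by (intro mono) simp
    then show "x \<in> B i" using \<iota>[OF x] by blast
  qed
  then show ?thesis using that i(1) by blast
qed

lemma directed_UN_PiE:
  assumes "directed_poset \<mu> I r" "\<And>i j. (i, j) \<in> r \<Longrightarrow> B i \<subseteq> B j"
    and X: "|X| <o \<mu>" and t: "t \<in> X \<rightarrow>\<^sub>E (\<Union>i\<in>I. B i)"
  obtains i where "i \<in> I" "t \<in> X \<rightarrow>\<^sub>E B i"
proof -
  have tX: "t ` X \<subseteq> (\<Union>i\<in>I. B i)" using PiE_mem[OF t] by blast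
  obtain i where "i \<in> I" "t ` X \<subseteq> B i"
    by (rule directed_UN_subset[where B = B, OF assms(1,2) tX card_of_image_ordLess[OF X]])
  then show ?thesis using that t by (simp add: PiE_iff image_subset_iff)
qed

lemma poset_cat_simps [simp]:
  "Obj (poset_cat I r) = I" "Arr (poset_cat I r) = r" "idt (poset_cat I r) i = (i, i)"
  "cmp (poset_cat I r) q p = (fst p, snd q)" "p \<in> hom (poset_cat I r) i j \<longleftrightarrow> p = (i, j) \<and> (i, j) \<in> r"
  by (auto simp: poset_cat_def hom_def)

lemma category_poset_cat:
  assumes "partial_order_on I r"
  shows "category (poset_cat I r)"
proof -
  have "r \<subseteq> I \<times> I" "\<And>i. i \<in> I \<Longrightarrow> (i, i) \<in> r" "\<And>i j k. (i, j) \<in> r \<Longrightarrow> (j, k) \<in> r \<Longrightarrow> (i, k) \<in> r"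
    using assms unfolding order_on_defs refl_on_def trans_def by blast+
  then show ?thesis by unfold_locales (auto simp: poset_cat_def hom_def)
qed

lemma is_functor_poset_cat:
  "is_functor (poset_cat I r) C G \<longleftrightarrow> category (poset_cat I r) \<and> category C \<and>
    (\<forall>i\<in>I. omap G i \<in> Obj C) \<and> (\<forall>(i, j)\<in>r. amap G (i, j) \<in> hom C (omap G i) (omap G j)) \<and>
    (\<forall>i\<in>I. amap G (i, i) = idt C (omap G i)) \<and>
    (\<forall>i j k. (i, j) \<in> r \<longrightarrow> (j, k) \<in> r \<longrightarrow> amap G (i, k) = cmp C (amap G (j, k)) (amap G (i, j)))"
  unfolding is_functor_def is_functor_axioms_def poset_cat_simps by auto

lemma is_cocone_poset_cat:
  "is_cocone (poset_cat I r) C G X c \<longleftrightarrow> X \<in> Obj C \<and> (\<forall>i\<in>I. c i \<in> hom C (omap G i) X) \<and>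
    (\<forall>(i, j)\<in>r. cmp C (c j) (amap G (i, j)) = c i)"
  unfolding is_cocone_def poset_cat_simps by auto

lemma functor_poset_catD:
  assumes "is_functor (poset_cat I r) C G"
  shows "i \<in> I \<Longrightarrow> omap G i \<in> Obj C"
    and "(i, j) \<in> r \<Longrightarrow> amap G (i, j) \<in> hom C (omap G i) (omap G j)"
    and "i \<in> I \<Longrightarrow> amap G (i, i) = idt C (omap G i)"
    and "(i, j) \<in> r \<Longrightarrow> (j, k) \<in> r \<Longrightarrow> amap G (i, k) = cmp C (amap G (j, k)) (amap G (i, j))"
    and "(i, j) \<in> r \<Longrightarrow> i \<in> I" "(i, j) \<in> r \<Longrightarrow> j \<in> I"
proof -
  interpret poset: category "poset_cat I r" using assms by (simp add: is_functor_poset_cat)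
  show "i \<in> I" "j \<in> I" if "(i, j) \<in> r"
    using poset.src_Obj[of "(i, j)"] poset.trg_Obj[of "(i, j)"] that by (auto simp: poset_cat_def)
qed (use assms in \<open>auto simp: is_functor_poset_cat\<close>)

lemma cocone_poset_catD:
  assumes "is_cocone (poset_cat I r) C G X c"
  shows "X \<in> Obj C" "i \<in> I \<Longrightarrow> c i \<in> hom C (omap G i) X"
    "(i, j) \<in> r \<Longrightarrow> cmp C (c j) (amap G (i, j)) = c i"
  using assms by (auto simp: is_cocone_poset_cat)


section \<open>Colimits\<close>

lemma colimit_is_cocone: "is_colimit J C G X c \<Longrightarrow> is_cocone J C G X c"
  by (simp add: is_colimit_def)

lemma colimit_factor:
  assumes "is_colimit J C G X c" "is_cocone J C G Y d"
  shows "\<exists>h \<in> hom C X Y. \<forall>i \<in> Obj J. cmp C h (c i) = d i"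
  using assms unfolding is_colimit_def by blast

lemma is_colimitI:
  assumes "is_cocone J C G X c"
    and "\<And>Y d. is_cocone J C G Y d \<Longrightarrow> \<exists>h \<in> hom C X Y. \<forall>i \<in> Obj J. cmp C h (c i) = d i"
    and "\<And>Y h h'. h \<in> hom C X Y \<Longrightarrow> h' \<in> hom C X Y \<Longrightarrow>
      (\<And>i. i \<in> Obj J \<Longrightarrow> cmp C h (c i) = cmp C h' (c i)) \<Longrightarrow> h = h'"
  shows "is_colimit J C G X c"
  unfolding is_colimit_def
proof (intro conjI allI impI)
  fix Y d assume "is_cocone J C G Y d"
  then obtain h where "h \<in> hom C X Y" "\<forall>i \<in> Obj J. cmp C h (c i) = d i" using assms(2) by blast
  then show "\<exists>!h. h \<in> hom C X Y \<and> (\<forall>i \<in> Obj J. cmp C h (c i) = d i)"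
    by (intro ex1I[of _ h]) (auto intro: assms(3))
qed (fact assms(1))

lemma is_colimit_poset_catI:
  assumes "is_cocone (poset_cat I r) C G X c"
    and "\<And>Y d. is_cocone (poset_cat I r) C G Y d \<Longrightarrow> \<exists>h \<in> hom C X Y. \<forall>i \<in> I. cmp C h (c i) = d i"
    and "\<And>Y h h'. h \<in> hom C X Y \<Longrightarrow> h' \<in> hom C X Y \<Longrightarrow>
      (\<And>i. i \<in> I \<Longrightarrow> cmp C h (c i) = cmp C h' (c i)) \<Longrightarrow> h = h'"
  shows "is_colimit (poset_cat I r) C G X c"
  using assms(2,3) by (intro is_colimitI[OF assms(1)]) simp_all

lemma colimit_poset_cat_factor:
  "is_colimit (poset_cat I r) C G X c \<Longrightarrow> is_cocone (poset_cat I r) C G Y d \<Longrightarrow>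
    \<exists>h \<in> hom C X Y. \<forall>i \<in> I. cmp C h (c i) = d i"
  using colimit_factor[of "poset_cat I r"] by simp

lemma (in category) hom_Obj:
  assumes "f \<in> hom C X Y"
  shows "X \<in> Obj C" "Y \<in> Obj C"
  using assms src_Obj trg_Obj by (auto simp: hom_def)

lemma is_cocone_postcompose:
  assumes "is_functor J C G" and cocone: "is_cocone J C G X c" and k: "k \<in> hom C X Y"
  shows "is_cocone J C G Y (\<lambda>i. cmp C k (c i))"
  unfolding is_cocone_def
proof (intro conjI ballI allI)
  interpret G: is_functor J C G by fact
  have c: "c i \<in> hom C (omap G i) X" if "i \<in> Obj J" for i
    using cocone that by (simp add: is_cocone_def)
  show "Y \<in> Obj C" using G.D.hom_Obj k by blast
  show "cmp C k (c i) \<in> hom C (omap G i) Y" if "i \<in> Obj J" for i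
    using G.D.cmp_hom[OF c[OF that] k] .
  show "cmp C (cmp C k (c j)) (amap G e) = cmp C k (c i)" if e: "e \<in> hom J i j" for i j e
  proof -
    have "cmp C (c j) (amap G e) = c i" using cocone e by (auto simp: is_cocone_def)
    then show ?thesis using G.D.cmp_assoc[OF G.amap_hom[OF e] c k] G.C.hom_Obj[OF e] by simp
  qed
qed

lemma is_cocone_functor_comp:
  assumes "is_functor C D F" "is_functor J C G" "is_cocone J C G X c"
  shows "is_cocone J D (functor_comp F G) (omap F X) (\<lambda>i. amap F (c i))"
  unfolding is_cocone_def
proof (intro conjI ballI allI)
  interpret F: is_functor C D F by fact
  interpret G: is_functor J C G by fact
  have c: "X \<in> Obj C" "\<And>i. i \<in> Obj J \<Longrightarrow> c i \<in> hom C (omap G i) X"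
      "\<And>i j e. e \<in> hom J i j \<Longrightarrow> cmp C (c j) (amap G e) = c i"
    using assms(3) by (auto simp: is_cocone_def)
  show "omap F X \<in> Obj D" using F.omap_Obj c(1) .
  show "amap F (c i) \<in> hom D (omap (functor_comp F G) i) (omap F X)" if "i \<in> Obj J" for i
    using F.amap_hom[OF c(2)[OF that]] by (simp add: functor_comp_def)
  show "cmp D (amap F (c j)) (amap (functor_comp F G) e) = amap F (c i)" if e: "e \<in> hom J i j" for i j e
    using F.amap_cmp[OF G.amap_hom[OF e] c(2)] c(3)[OF e] G.C.hom_Obj[OF e]
    by (simp add: functor_comp_def)
qed

lemma colimit_jointly_epic:
  assumes G: "is_functor J C G" and colim: "is_colimit J C G X c"
    and hom: "h \<in> hom C X Y" "h' \<in> hom C X Y"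
    and eq: "\<And>i. i \<in> Obj J \<Longrightarrow> cmp C h (c i) = cmp C h' (c i)"
  shows "h = h'"
proof -
  have "is_cocone J C G Y (\<lambda>i. cmp C h (c i))"
    using is_cocone_postcompose[OF G colimit_is_cocone[OF colim] hom(1)] .
  then have "\<exists>!k. k \<in> hom C X Y \<and> (\<forall>i \<in> Obj J. cmp C k (c i) = cmp C h (c i))"
    using colim by (simp add: is_colimit_def)
  then show ?thesis using hom eq by metis
qed

lemma colimit_endomorphism_eq_idt:
  assumes G: "is_functor J C G" and colim: "is_colimit J C G X c"
    and h: "h \<in> hom C X X" "\<And>i. i \<in> Obj J \<Longrightarrow> cmp C h (c i) = c i"
  shows "h = idt C X"
proof (rule colimit_jointly_epic[OF G colim h(1)])
  interpret G: is_functor J C G by fact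
  show "idt C X \<in> hom C X X" using G.D.idt_hom G.D.hom_Obj[OF h(1)] by blast
  fix i assume i: "i \<in> Obj J"
  then have "c i \<in> hom C (omap G i) X" using colimit_is_cocone[OF colim] by (simp add: is_cocone_def)
  then show "cmp C h (c i) = cmp C (idt C X) (c i)" using G.D.cmp_idt_left h(2)[OF i] by metis
qed

lemma colimit_unique:
  assumes G: "is_functor J C G" and X: "is_colimit J C G X c" and Y: "is_colimit J C G Y d"
  shows "isomorphic C X Y"
proof -
  interpret G: is_functor J C G by fact
  have c: "c i \<in> hom C (omap G i) X" and d: "d i \<in> hom C (omap G i) Y" if "i \<in> Obj J" for i
    using that colimit_is_cocone[OF X] colimit_is_cocone[OF Y] by (auto simp: is_cocone_def)
  obtain f where f: "f \<in> hom C X Y" "\<And>i. i \<in> Obj J \<Longrightarrow> cmp C f (c i) = d i"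
    using colimit_factor[OF X colimit_is_cocone[OF Y]] by blast
  obtain g where g: "g \<in> hom C Y X" "\<And>i. i \<in> Obj J \<Longrightarrow> cmp C g (d i) = c i"
    using colimit_factor[OF Y colimit_is_cocone[OF X]] by blast
  have "cmp C g f = idt C X"
    using G.D.cmp_assoc[OF c f(1) g(1)] f(2) g(2)
    by (intro colimit_endomorphism_eq_idt[OF G X G.D.cmp_hom[OF f(1) g(1)]]) simp
  moreover have "cmp C f g = idt C Y"
    using G.D.cmp_assoc[OF d g(1) f(1)] f(2) g(2)
    by (intro colimit_endomorphism_eq_idt[OF G Y G.D.cmp_hom[OF g(1) f(1)]]) simp
  ultimately show ?thesis
    using f(1) g(1) G.D.hom_Obj[OF f(1)] unfolding isomorphic_def by blast
qed


section \<open>Diagrams of subobjects\<close>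

definition factorization :: "('o, 'm) cat \<Rightarrow> 'm \<Rightarrow> 'm \<Rightarrow> 'm \<Rightarrow> bool" where
  "factorization C a b f \<longleftrightarrow> f \<in> hom C (src C a) (src C b) \<and> cmp C b f = a"

definition factor_order :: "('o, 'm) cat \<Rightarrow> 'i set \<Rightarrow> ('i \<Rightarrow> 'm) \<Rightarrow> 'i rel" where
  "factor_order C I c = {(i, j). i \<in> I \<and> j \<in> I \<and> (\<exists>f. factorization C (c i) (c j) f)}"

definition subobject_diagram :: "('o, 'm) cat \<Rightarrow> ('i \<Rightarrow> 'm) \<Rightarrow> ('i, 'i \<times> 'i, 'o, 'm) fnctr" where
  "subobject_diagram C c =
    \<lparr>omap = (\<lambda>i. src C (c i)), amap = (\<lambda>(i, j). THE f. factorization C (c i) (c j) f)\<rparr>"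

definition separated :: "'i rel \<Rightarrow> ('i, 'i \<times> 'i, 'o, 'm) fnctr \<Rightarrow> bool" where
  "separated r G \<longleftrightarrow>
    (\<forall>i j k. (i, k) \<in> r \<longrightarrow> (j, k) \<in> r \<longrightarrow> amap G (i, k) = amap G (j, k) \<longrightarrow> i = j)"

lemma omap_subobject_diagram [simp]: "omap (subobject_diagram C c) i = src C (c i)"
  by (simp add: subobject_diagram_def)

lemma Restr_factor_order: "J \<subseteq> I \<Longrightarrow> Restr (factor_order C I c) J = factor_order C J c"
  by (auto simp: factor_order_def)

context category
begin

lemma monic_cancel:
  assumes "monomorphism C m" "m \<in> hom C X Y" "f \<in> hom C W X" "g \<in> hom C W X"
    "cmp C m f = cmp C m g"
  shows "f = g"
  using assms by (auto simp: monomorphism_def hom_def)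

lemma factorization_idt: "a \<in> Arr C \<Longrightarrow> factorization C a a (idt C (src C a))"
  using idt_hom[OF src_Obj] cmp_idt_right[of a "src C a" "trg C a"]
  by (simp add: factorization_def hom_def)

lemma factorization_cmp:
  assumes "factorization C a b f" "factorization C b d g" "d \<in> Arr C"
  shows "factorization C a d (cmp C g f)"
  using assms cmp_assoc[of f "src C a" "src C b" g "src C d" d "trg C d"]
    cmp_hom[of f "src C a" "src C b" g "src C d"] by (auto simp: factorization_def hom_def)

lemma factorization_unique:
  assumes "monomorphism C b" "factorization C a b f" "factorization C a b g"
  shows "f = g"
  using assms monic_cancel[of b "src C b" "trg C b" f "src C a" g]
  by (auto simp: factorization_def monomorphism_def hom_def)

lemma factorization_cocone:
  assumes G: "is_functor (poset_cat I r) C G" and c: "is_cocone (poset_cat I r) C G X c"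
    and ij: "(i, j) \<in> r"
  shows "factorization C (c i) (c j) (amap G (i, j))"
  using functor_poset_catD(2)[OF G ij] cocone_poset_catD(2)[OF c functor_poset_catD(5)[OF G ij]]
    cocone_poset_catD(2)[OF c functor_poset_catD(6)[OF G ij]] cocone_poset_catD(3)[OF c ij]
  by (simp add: factorization_def hom_def)

lemma preorder_on_factor_order:
  assumes "\<And>i. i \<in> I \<Longrightarrow> c i \<in> Arr C"
  shows "preorder_on I (factor_order C I c)"
proof -
  have "refl_on I (factor_order C I c)"
    using factorization_idt assms by (auto simp: refl_on_def factor_order_def)
  moreover have "trans (factor_order C I c)"
    using factorization_cmp assms unfolding trans_def factor_order_def by blast
  ultimately show ?thesis by (auto simp: preorder_on_def factor_order_def)
qed

context
  fixes I :: "'i set" and c :: "'i \<Rightarrow> 'm"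
  assumes monic: "\<And>i. i \<in> I \<Longrightarrow> monomorphism C (c i)"
begin

lemma subobject_diagram_eq_iff:
  assumes "(i, j) \<in> factor_order C I c"
  shows "amap (subobject_diagram C c) (i, j) = f \<longleftrightarrow> factorization C (c i) (c j) f"
proof -
  obtain g where j: "j \<in> I" and g: "factorization C (c i) (c j) g"
    using assms by (auto simp: factor_order_def)
  note unique = factorization_unique[OF monic[OF j]]
  have "(THE f. factorization C (c i) (c j) f) = g"
    using g by (rule the_equality) (rule unique[OF _ g])
  then have "amap (subobject_diagram C c) (i, j) = g" by (simp add: subobject_diagram_def)
  then show ?thesis using g unique[OF g] by metis
qed

lemma factorization_subobject_diagram:
  assumes "(i, j) \<in> factor_order C I c"
  shows "factorization C (c i) (c j) (amap (subobject_diagram C c) (i, j))"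
  using subobject_diagram_eq_iff[OF assms] by blast

lemma is_functor_subobject_diagram:
  assumes "antisym (factor_order C I c)"
  shows "is_functor (poset_cat I (factor_order C I c)) C (subobject_diagram C c)"
  unfolding is_functor_poset_cat
proof (intro conjI ballI allI impI)
  let ?le = "factor_order C I c" and ?D = "subobject_diagram C c"
  note arrow = monic[unfolded monomorphism_def, THEN conjunct1]
  have order: "preorder_on I ?le" by (rule preorder_on_factor_order) (rule arrow)
  show "category (poset_cat I ?le)"
    using order assms category_poset_cat by (auto simp: partial_order_on_def)
  show "category C" by unfold_locales
  show "omap ?D i \<in> Obj C" if "i \<in> I" for i using src_Obj[OF arrow[OF that]] by simp
  show "case p of (i, j) \<Rightarrow> amap ?D (i, j) \<in> hom C (omap ?D i) (omap ?D j)" if "p \<in> ?le" for p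
    using that factorization_subobject_diagram by (auto simp: factorization_def)
  show "amap ?D (i, i) = idt C (omap ?D i)" if "i \<in> I" for i
    using subobject_diagram_eq_iff[of i i] factorization_idt[OF arrow[OF that]] that
    by (auto simp: factor_order_def)
  fix i j k assume ij: "(i, j) \<in> ?le" and jk: "(j, k) \<in> ?le"
  have k: "k \<in> I" and ik: "(i, k) \<in> ?le"
    using order ij jk by (auto simp: preorder_on_def factor_order_def dest: transD)
  show "amap ?D (i, k) = cmp C (amap ?D (j, k)) (amap ?D (i, j))"
    using subobject_diagram_eq_iff[OF ik] arrow[OF k]
      factorization_cmp[OF factorization_subobject_diagram[OF ij] factorization_subobject_diagram[OF jk]]
    by blast
qed

lemma separated_subobject_diagram:
  assumes "antisym (factor_order C I c)"
  shows "separated (factor_order C I c) (subobject_diagram C c)"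
  unfolding separated_def
proof (intro allI impI)
  fix i j k
  assume ik: "(i, k) \<in> factor_order C I c" and jk: "(j, k) \<in> factor_order C I c"
    and eq: "amap (subobject_diagram C c) (i, k) = amap (subobject_diagram C c) (j, k)"
  have ij: "i \<in> I" "j \<in> I" using ik jk by (auto simp: factor_order_def)
  have "c i = c j"
    using factorization_subobject_diagram[OF ik] factorization_subobject_diagram[OF jk] eq
    by (simp add: factorization_def)
  moreover have "factorization C (c i) (c i) (idt C (src C (c i)))"
    using factorization_idt monic[OF ij(1)] by (simp add: monomorphism_def)
  ultimately have "(i, j) \<in> factor_order C I c" "(j, i) \<in> factor_order C I c"
    using ij by (auto simp: factor_order_def)
  then show "i = j" using assms by (rule antisymD[rotated])
qed

lemma is_cocone_subobject_diagram:
  "is_cocone (poset_cat I (factor_order C I c)) C (subobject_diagram C c) X d \<longleftrightarrow> X \<in> Obj C \<and>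
    (\<forall>i\<in>I. d i \<in> hom C (src C (c i)) X) \<and>
    (\<forall>i\<in>I. \<forall>j\<in>I. \<forall>f. factorization C (c i) (c j) f \<longrightarrow> cmp C (d j) f = d i)"
proof -
  let ?le = "factor_order C I c" and ?D = "subobject_diagram C c"
  have "(\<forall>(i, j)\<in>?le. cmp C (d j) (amap ?D (i, j)) = d i) \<longleftrightarrow>
      (\<forall>i\<in>I. \<forall>j\<in>I. \<forall>f. factorization C (c i) (c j) f \<longrightarrow> cmp C (d j) f = d i)"
  proof (intro iffI ballI allI impI)
    fix i j f assume d: "\<forall>(i, j)\<in>?le. cmp C (d j) (amap ?D (i, j)) = d i"
      and ij: "i \<in> I" "j \<in> I" and f: "factorization C (c i) (c j) f"
    have le: "(i, j) \<in> ?le" using ij f by (auto simp: factor_order_def)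
    have "amap ?D (i, j) = f" using f subobject_diagram_eq_iff[OF le] by simp
    then show "cmp C (d j) f = d i" using d le by blast
  next
    fix p assume p: "p \<in> ?le"
      and d: "\<forall>i\<in>I. \<forall>j\<in>I. \<forall>f. factorization C (c i) (c j) f \<longrightarrow> cmp C (d j) f = d i"
    obtain i j where "p = (i, j)" "i \<in> I" "j \<in> I" using p by (auto simp: factor_order_def)
    then show "case p of (i, j) \<Rightarrow> cmp C (d j) (amap ?D (i, j)) = d i"
      using d p factorization_subobject_diagram[of i j] by simp
  qed
  then show ?thesis by (simp add: is_cocone_poset_cat)
qed

lemma subobject_cocone_cmp_eq:
  assumes d: "is_cocone (poset_cat I (factor_order C I c)) C (subobject_diagram C c) Y d"
    and directed: "\<exists>k\<in>I. (i, k) \<in> factor_order C I c \<and> (j, k) \<in> factor_order C I c"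
    and f: "factorization C a (c i) f" and g: "factorization C a (c j) g"
  shows "cmp C (d i) f = cmp C (d j) g"
proof -
  obtain k u v where k: "i \<in> I" "j \<in> I" "k \<in> I"
    and u: "factorization C (c i) (c k) u" and v: "factorization C (c j) (c k) v"
    using directed by (auto simp: factor_order_def)
  have dk: "d k \<in> hom C (src C (c k)) Y" and du: "cmp C (d k) u = d i" and dv: "cmp C (d k) v = d j"
    using d k u v unfolding is_cocone_subobject_diagram by blast+
  have "c k \<in> Arr C" using monic[OF k(3)] by (simp add: monomorphism_def)
  then have "cmp C u f = cmp C v g"
    using factorization_unique[OF monic[OF k(3)]] factorization_cmp[OF f u] factorization_cmp[OF g v]
    by blast
  then show ?thesis
    using cmp_assoc[OF _ _ dk] f g u v du dv unfolding factorization_def by metis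
qed

end

text \<open>Passing to a cofinal set \<open>J\<close> of subobjects: a cocone over \<open>J\<close> extends to \<open>I\<close> by composing
  with any factorization through a leg indexed by \<open>J\<close>.\<close>

lemma subobject_cocone_extend:
  assumes G: "is_functor (poset_cat I r) C G" and c: "is_cocone (poset_cat I r) C G X c"
    and monic: "\<And>j. j \<in> J \<Longrightarrow> monomorphism C (c j)"
    and directed: "\<And>i j. i \<in> J \<Longrightarrow> j \<in> J \<Longrightarrow>
      \<exists>k\<in>J. (i, k) \<in> factor_order C J c \<and> (j, k) \<in> factor_order C J c"
    and \<rho>: "\<And>i. i \<in> I \<Longrightarrow> \<rho> i \<in> J"
    and u: "\<And>i. i \<in> I \<Longrightarrow> factorization C (c i) (c (\<rho> i)) (u i)"
    and d: "is_cocone (poset_cat J (factor_order C J c)) C (subobject_diagram C c) Y d"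
  shows "is_cocone (poset_cat I r) C G Y (\<lambda>i. cmp C (d (\<rho> i)) (u i))"
  unfolding is_cocone_poset_cat
proof (intro conjI ballI)
  have dJ: "d j \<in> hom C (src C (c j)) Y" if "j \<in> J" for j using cocone_poset_catD(2)[OF d that] by simp
  have uI: "u i \<in> hom C (src C (c i)) (src C (c (\<rho> i)))" if "i \<in> I" for i
    using u[OF that] by (simp add: factorization_def)
  show "Y \<in> Obj C" using cocone_poset_catD(1)[OF d] .
  show "cmp C (d (\<rho> i)) (u i) \<in> hom C (omap G i) Y" if i: "i \<in> I" for i
    using cmp_hom[OF uI[OF i] dJ[OF \<rho>[OF i]]] cocone_poset_catD(2)[OF c i] by (simp add: hom_def)
  show "case p of (i, j) \<Rightarrow> cmp C (cmp C (d (\<rho> j)) (u j)) (amap G (i, j)) = cmp C (d (\<rho> i)) (u i)"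
    if p: "p \<in> r" for p
  proof -
    obtain i j where ij: "p = (i, j)" "i \<in> I" "j \<in> I"
      using p functor_poset_catD(5,6)[OF G] by (cases p) auto
    note \<rho>i = \<rho>[OF ij(2)] and \<rho>j = \<rho>[OF ij(3)]
    have g: "factorization C (c i) (c j) (amap G (i, j))"
      using factorization_cocone[OF G c] p ij(1) by simp
    have "c (\<rho> j) \<in> Arr C" using monic[OF \<rho>j] by (simp add: monomorphism_def)
    then have ug: "factorization C (c i) (c (\<rho> j)) (cmp C (u j) (amap G (i, j)))"
      by (rule factorization_cmp[OF g u[OF ij(3)]])
    have "cmp C (d (\<rho> j)) (cmp C (u j) (amap G (i, j))) = cmp C (d (\<rho> i)) (u i)"
      by (rule subobject_cocone_cmp_eq[OF monic d directed[OF \<rho>j \<rho>i] ug u[OF ij(2)]])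
    moreover have "amap G (i, j) \<in> hom C (src C (c i)) (src C (c j))"
      using g by (simp add: factorization_def)
    ultimately show ?thesis using cmp_assoc[OF _ uI[OF ij(3)] dJ[OF \<rho>j]] by (simp add: ij(1))
  qed
qed

lemma is_colimit_subobject_diagram:
  assumes G: "is_functor (poset_cat I r) C G" and colim: "is_colimit (poset_cat I r) C G X c"
    and J: "J \<subseteq> I" and monic: "\<And>j. j \<in> J \<Longrightarrow> monomorphism C (c j)"
    and cofinal: "\<And>i. i \<in> I \<Longrightarrow> \<exists>j\<in>J. (i, j) \<in> factor_order C I c"
    and directed: "\<And>i j. i \<in> J \<Longrightarrow> j \<in> J \<Longrightarrow>
      \<exists>k\<in>J. (i, k) \<in> factor_order C J c \<and> (j, k) \<in> factor_order C J c"
  shows "is_colimit (poset_cat J (factor_order C J c)) C (subobject_diagram C c) X c"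
proof (rule is_colimit_poset_catI)
  note cocone = colimit_is_cocone[OF colim]
  have c: "c i \<in> hom C (src C (c i)) X" if "i \<in> I" for i
    using cocone_poset_catD(2)[OF cocone that] by (auto simp: hom_def)
  have "\<forall>i\<in>I. \<exists>j f. j \<in> J \<and> factorization C (c i) (c j) f"
    using cofinal unfolding factor_order_def by blast
  then obtain \<rho> u where \<rho>: "\<And>i. i \<in> I \<Longrightarrow> \<rho> i \<in> J"
    and u: "\<And>i. i \<in> I \<Longrightarrow> factorization C (c i) (c (\<rho> i)) (u i)"
    by metis
  show "is_cocone (poset_cat J (factor_order C J c)) C (subobject_diagram C c) X c"
    using is_cocone_subobject_diagram[of J c, OF monic] cocone_poset_catD(1)[OF cocone] c J
    by (auto simp: factorization_def)
  show "h = h'" if h: "h \<in> hom C X Y" "h' \<in> hom C X Y"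
    and eq: "\<And>j. j \<in> J \<Longrightarrow> cmp C h (c j) = cmp C h' (c j)" for Y h h'
  proof (rule colimit_jointly_epic[OF G colim h])
    fix i assume "i \<in> Obj (poset_cat I r)"
    then have i: "i \<in> I" by simp
    have "u i \<in> hom C (src C (c i)) (src C (c (\<rho> i)))" "cmp C (c (\<rho> i)) (u i) = c i"
      using u[OF i] by (auto simp: factorization_def)
    then show "cmp C h (c i) = cmp C h' (c i)"
      using cmp_assoc[OF _ c h(1)] cmp_assoc[OF _ c h(2)] eq[OF \<rho>[OF i]] subsetD[OF J \<rho>[OF i]]
      by metis
  qed
  fix Y d assume d: "is_cocone (poset_cat J (factor_order C J c)) C (subobject_diagram C c) Y d"
  obtain h where h: "h \<in> hom C X Y" "\<And>i. i \<in> I \<Longrightarrow> cmp C h (c i) = cmp C (d (\<rho> i)) (u i)"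
    using colimit_poset_cat_factor[OF colim subobject_cocone_extend[OF G cocone monic directed \<rho> u d]]
    by blast
  have "cmp C h (c j) = d j" if j: "j \<in> J" for j
  proof -
    have jI: "j \<in> I" using J j by blast
    have id: "factorization C (c j) (c j) (idt C (src C (c j)))"
      using factorization_idt monic[OF j] by (simp add: monomorphism_def)
    have "cmp C (d (\<rho> j)) (u j) = cmp C (d j) (idt C (src C (c j)))"
      by (rule subobject_cocone_cmp_eq[OF monic d directed[OF \<rho>[OF jI] j] u[OF jI] id])
    then show ?thesis using h(2)[OF jI] cmp_idt_right cocone_poset_catD(2)[OF d j] by simp
  qed
  then show "\<exists>h\<in>hom C X Y. \<forall>j\<in>J. cmp C h (c j) = d j" using h(1) by blast
qed

lemma directed_poset_factor_order:
  fixes I :: "'u set"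
  assumes dir: "directed_poset \<nu> I r" and G: "is_functor (poset_cat I r) C G"
    and cocone: "is_cocone (poset_cat I r) C G X c"
    and J: "J \<subseteq> I" and antisym: "antisym (factor_order C J c)"
    and cofinal: "\<And>i. i \<in> I \<Longrightarrow> \<exists>j\<in>J. (i, j) \<in> factor_order C I c"
  shows "directed_poset \<nu> J (factor_order C J c)"
  unfolding directed_poset_def
proof (intro conjI allI impI)
  have c: "c i \<in> Arr C" if "i \<in> I" for i
    using cocone_poset_catD(2)[OF cocone that] by (simp add: hom_def)
  show "small TYPE('u) J" using small_subset[OF directed_poset_small[OF dir] J] .
  show "partial_order_on J (factor_order C J c)"
    using preorder_on_factor_order[of J c] c J antisym by (auto simp: partial_order_on_def)
  fix A assume A: "A \<subseteq> J" "|A| <o \<nu>"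
  obtain k where k: "k \<in> I" "\<And>x. x \<in> A \<Longrightarrow> (x, k) \<in> r"
    using directed_poset_bound[OF dir subset_trans[OF A(1) J] A(2)] by metis
  obtain b where b: "b \<in> J" "(k, b) \<in> factor_order C I c" using cofinal[OF k(1)] by blast
  have trans: "trans (factor_order C I c)"
    using preorder_on_factor_order[of I c] c by (simp add: preorder_on_def)
  have "(x, b) \<in> factor_order C J c" if x: "x \<in> A" for x
  proof -
    have "(x, k) \<in> factor_order C I c"
      using factorization_cocone[OF G cocone k(2)[OF x]] k(1) A(1) J x
      by (auto simp: factor_order_def)
    then have "(x, b) \<in> factor_order C I c" using transD[OF trans] b(2) by blast
    then show ?thesis using b(1) A(1) x by (auto simp: factor_order_def)
  qed
  then show "\<exists>b\<in>J. \<forall>x\<in>A. (x, b) \<in> factor_order C J c" using b(1) by blast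
qed

lemma directed_colimit_separated:
  fixes I :: "'u set"
  assumes \<nu>: "regular_cardinal \<nu>" and monic: "\<forall>f\<in>Arr C. monomorphism C f"
    and dir: "directed_poset \<nu> I r" and G: "is_functor (poset_cat I r) C G"
    and colim: "is_colimit (poset_cat I r) C G X c"
  obtains J q H where "J \<subseteq> I" "directed_poset \<nu> J q" "is_functor (poset_cat J q) C H"
    "separated q H" "\<And>j. j \<in> J \<Longrightarrow> omap H j = omap G j" "is_colimit (poset_cat J q) C H X c"
proof -
  note cocone = colimit_is_cocone[OF colim]
  have c: "c i \<in> Arr C" "src C (c i) = omap G i" if "i \<in> I" for i
    using cocone_poset_catD(2)[OF cocone that] by (auto simp: hom_def)
  have "preorder_on I (factor_order C I c)" by (rule preorder_on_factor_order) (rule c(1))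
  then obtain J where J: "J \<subseteq> I" "antisym (Restr (factor_order C I c) J)" and
    rep: "\<And>i. i \<in> I \<Longrightarrow> \<exists>j\<in>J. (i, j) \<in> factor_order C I c \<and> (j, i) \<in> factor_order C I c"
    using preorder_on_skeleton by blast
  let ?q = "factor_order C J c"
  have antisym: "antisym ?q" using J(2) by (simp only: Restr_factor_order[OF J(1)])
  have cofinal: "\<exists>j\<in>J. (i, j) \<in> factor_order C I c" if "i \<in> I" for i using rep[OF that] by blast
  have monicJ: "monomorphism C (c j)" if "j \<in> J" for j using monic c(1) J(1) that by blast
  have dirJ: "directed_poset \<nu> J ?q"
    by (rule directed_poset_factor_order[OF dir G cocone J(1) antisym cofinal])
  show ?thesis
  proof
    show "is_functor (poset_cat J ?q) C (subobject_diagram C c)" "separated ?q (subobject_diagram C c)"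
      using is_functor_subobject_diagram[of J c] separated_subobject_diagram[of J c] monicJ antisym
      by auto
    show "is_colimit (poset_cat J ?q) C (subobject_diagram C c) X c"
      using directed_poset_bound_pair[OF \<nu> dirJ]
      by (intro is_colimit_subobject_diagram[OF G colim J(1) monicJ cofinal]) metis+
  qed (use J(1) dirJ c(2) in auto)
qed

end


section \<open>Structures and embeddings\<close>

lemma compose_PiE: "h \<in> A \<rightarrow> B \<Longrightarrow> t \<in> X \<rightarrow>\<^sub>E A \<Longrightarrow> compose X h t \<in> X \<rightarrow>\<^sub>E B"
  by (simp add: extensional_funcset_def funcset_compose[of t X A h B])

lemma Id_compose_PiE: "t \<in> X \<rightarrow>\<^sub>E A \<Longrightarrow> compose X (\<lambda>x\<in>A. x) t = t"
  by (simp add: extensional_funcset_def Id_compose)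

lemma compose_assoc_PiE:
  "t \<in> X \<rightarrow>\<^sub>E A \<Longrightarrow> compose X (compose A g h) t = compose X g (compose X h t)"
  by (rule compose_assoc[symmetric]) (auto simp: extensional_funcset_def)

lemma PiE_image_lift:
  assumes "t \<in> X \<rightarrow>\<^sub>E h ` A"
  obtains s where "s \<in> X \<rightarrow>\<^sub>E A" "compose X h s = t"
proof
  let ?s = "compose X (inv_into A h) t"
  show "?s \<in> X \<rightarrow>\<^sub>E A" using assms by (rule compose_PiE[rotated]) (simp add: inv_into_into)
  show "compose X h ?s = t"
  proof (rule extensionalityI)
    show "compose X h ?s a = t a" if "a \<in> X" for a
      using PiE_mem[OF assms that] that by (simp add: compose_eq f_inv_into_f)
  qed (use assms in \<open>auto simp: extensional_funcset_def\<close>)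
qed

lemma struct_small: "is_struct \<tau> M \<Longrightarrow> small TYPE('u) (carrier (M :: 'u struct))"
  by (simp add: is_struct_def)

lemma fun_interp_carrier:
  assumes "is_struct \<tau> M" "f \<in> funs \<tau>" "t \<in> fun_arity \<tau> f \<rightarrow>\<^sub>E carrier M"
  shows "fun_interp M f t \<in> carrier M"
proof -
  have "fun_interp M \<in> (\<Pi>\<^sub>E f \<in> funs \<tau>. (fun_arity \<tau> f \<rightarrow>\<^sub>E carrier M) \<rightarrow>\<^sub>E carrier M)"
    using assms(1) by (simp add: is_struct_def)
  from PiE_mem[OF PiE_mem[OF this assms(2)] assms(3)] show ?thesis .
qed

lemma rel_interp_PiE:
  "is_struct \<tau> M \<Longrightarrow> R \<in> rels \<tau> \<Longrightarrow> t \<in> rel_interp M R \<Longrightarrow> t \<in> rel_arity \<tau> R \<rightarrow>\<^sub>E carrier M"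
  unfolding is_struct_def by blast

definition restrict_struct :: "'u vocabulary \<Rightarrow> 'u struct \<Rightarrow> 'u set \<Rightarrow> 'u struct" where
  "restrict_struct \<tau> N A = \<lparr>carrier = A,
    fun_interp = (\<lambda>f\<in>funs \<tau>. \<lambda>t \<in> fun_arity \<tau> f \<rightarrow>\<^sub>E A. fun_interp N f t),
    rel_interp = (\<lambda>R. rel_interp N R \<inter> (rel_arity \<tau> R \<rightarrow>\<^sub>E A))\<rparr>"

lemma carrier_restrict_struct [simp]: "carrier (restrict_struct \<tau> N A) = A"
  by (simp add: restrict_struct_def)

lemma substructure_restrict_struct:
  assumes "is_struct \<tau> N" "A \<subseteq> carrier N"
    and "\<And>f t. f \<in> funs \<tau> \<Longrightarrow> t \<in> fun_arity \<tau> f \<rightarrow>\<^sub>E A \<Longrightarrow> fun_interp N f t \<in> A"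
  shows "substructure \<tau> (restrict_struct \<tau> N A) N"
proof -
  have "is_struct \<tau> (restrict_struct \<tau> N A)"
    using assms(1,3) small_subset[OF struct_small[OF assms(1)] assms(2)]
    by (simp add: is_struct_def restrict_struct_def)
  then show ?thesis
    using assms(1,2) by (simp add: substructure_def restrict_struct_def)
qed

lemma fun_interp_image_closed:
  assumes "is_struct \<tau> M" and f: "f \<in> funs \<tau>"
    and hom: "\<And>s. s \<in> fun_arity \<tau> f \<rightarrow>\<^sub>E carrier M \<Longrightarrow>
      h (fun_interp M f s) = fun_interp N f (compose (fun_arity \<tau> f) h s)"
    and t: "t \<in> fun_arity \<tau> f \<rightarrow>\<^sub>E h ` carrier M"
  shows "fun_interp N f t \<in> h ` carrier M"
proof -
  obtain s where s: "s \<in> fun_arity \<tau> f \<rightarrow>\<^sub>E carrier M" "compose (fun_arity \<tau> f) h s = t"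
    using PiE_image_lift[OF t] by metis
  then have "fun_interp N f t = h (fun_interp M f s)" using hom by simp
  then show ?thesis using fun_interp_carrier[OF assms(1) f s(1)] by simp
qed

lemma embeddingI:
  fixes \<tau> :: "'u vocabulary"
  assumes "is_struct \<tau> M" "is_struct \<tau> N"
    and h: "h \<in> carrier M \<rightarrow>\<^sub>E carrier N" "inj_on h (carrier M)"
    and funs: "\<And>f t. f \<in> funs \<tau> \<Longrightarrow> t \<in> fun_arity \<tau> f \<rightarrow>\<^sub>E carrier M \<Longrightarrow>
      h (fun_interp M f t) = fun_interp N f (compose (fun_arity \<tau> f) h t)"
    and rels: "\<And>R t. R \<in> rels \<tau> \<Longrightarrow> t \<in> rel_arity \<tau> R \<rightarrow>\<^sub>E carrier M \<Longrightarrow>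
      t \<in> rel_interp M R \<longleftrightarrow> compose (rel_arity \<tau> R) h t \<in> rel_interp N R"
  shows "embedding \<tau> h M N"
proof -
  define N' where "N' = restrict_struct \<tau> N (h ` carrier M)"
  have sub: "substructure \<tau> N' N"
    unfolding N'_def
  proof (rule substructure_restrict_struct)
    show "fun_interp N f t \<in> h ` carrier M"
      if "f \<in> funs \<tau>" "t \<in> fun_arity \<tau> f \<rightarrow>\<^sub>E h ` carrier M" for f t
      using fun_interp_image_closed[OF assms(1) that(1) funs[OF that(1)] that(2)] .
  qed (use assms(2) h(1) in auto)
  have image: "compose X h t \<in> X \<rightarrow>\<^sub>E h ` carrier M" if "t \<in> X \<rightarrow>\<^sub>E carrier M" for X and t :: "'u \<Rightarrow> 'u"
    by (rule compose_PiE[OF _ that]) simp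
  have "struct_iso \<tau> h M N'"
    using assms(1) sub h funs rels image unfolding struct_iso_def substructure_def
    by (simp add: N'_def restrict_struct_def bij_betw_def extensional_funcset_def)
  with sub show ?thesis by (auto simp: embedding_def)
qed

lemma embedding_iff:
  fixes \<tau> :: "'u vocabulary"
  shows "embedding \<tau> h M N \<longleftrightarrow> is_struct \<tau> M \<and> is_struct \<tau> N \<and> h \<in> carrier M \<rightarrow>\<^sub>E carrier N \<and>
    inj_on h (carrier M) \<and>
    (\<forall>f \<in> funs \<tau>. \<forall>t \<in> fun_arity \<tau> f \<rightarrow>\<^sub>E carrier M.
      h (fun_interp M f t) = fun_interp N f (compose (fun_arity \<tau> f) h t)) \<and>
    (\<forall>R \<in> rels \<tau>. \<forall>t \<in> rel_arity \<tau> R \<rightarrow>\<^sub>E carrier M.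
      t \<in> rel_interp M R \<longleftrightarrow> compose (rel_arity \<tau> R) h t \<in> rel_interp N R)" (is "_ \<longleftrightarrow> ?strong_hom")
proof
  assume "embedding \<tau> h M N"
  then obtain N' where N': "substructure \<tau> N' N" "struct_iso \<tau> h M N'"
    by (auto simp: embedding_def)
  then have bij: "bij_betw h (carrier M) (carrier N')" "carrier N' \<subseteq> carrier N"
    by (auto simp: struct_iso_def substructure_def)
  then have h: "h \<in> carrier M \<rightarrow> carrier N'" by (auto simp: bij_betw_def)
  have "compose X h t \<in> X \<rightarrow>\<^sub>E carrier N'" if "t \<in> X \<rightarrow>\<^sub>E carrier M" for X and t :: "'u \<Rightarrow> 'u"
    using compose_PiE[OF h that] .
  moreover have "h \<in> carrier M \<rightarrow>\<^sub>E carrier N"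
    using N'(2) h bij(2) by (auto simp: struct_iso_def extensional_funcset_def)
  ultimately show ?strong_hom
    using N' bij(1) unfolding struct_iso_def substructure_def bij_betw_def by simp
next
  assume ?strong_hom
  then show "embedding \<tau> h M N" by (intro embeddingI) simp_all
qed

lemma embeddingD:
  assumes "embedding \<tau> h M N"
  shows "is_struct \<tau> M" "is_struct \<tau> N" "h \<in> carrier M \<rightarrow>\<^sub>E carrier N" "inj_on h (carrier M)"
    "x \<in> carrier M \<Longrightarrow> h x \<in> carrier N"
    "f \<in> funs \<tau> \<Longrightarrow> t \<in> fun_arity \<tau> f \<rightarrow>\<^sub>E carrier M \<Longrightarrow>
      h (fun_interp M f t) = fun_interp N f (compose (fun_arity \<tau> f) h t)"
    "R \<in> rels \<tau> \<Longrightarrow> t \<in> rel_arity \<tau> R \<rightarrow>\<^sub>E carrier M \<Longrightarrow>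
      t \<in> rel_interp M R \<longleftrightarrow> compose (rel_arity \<tau> R) h t \<in> rel_interp N R"
  using assms unfolding embedding_iff by (blast dest: PiE_mem)+

lemma substructure_embedding:
  assumes "substructure \<tau> M N"
  shows "embedding \<tau> (\<lambda>x\<in>carrier M. x) M N"
  using assms fun_interp_carrier[of \<tau> M] unfolding embedding_iff substructure_def
  by (auto simp: Id_compose_PiE inj_on_def)

lemma embedding_id: "is_struct \<tau> M \<Longrightarrow> embedding \<tau> (\<lambda>x\<in>carrier M. x) M M"
  unfolding embedding_iff by (auto simp: Id_compose_PiE fun_interp_carrier inj_on_def)

lemma embedding_compose:
  fixes \<tau> :: "'u vocabulary"
  assumes h: "embedding \<tau> h M N" and g: "embedding \<tau> g N P"
  shows "embedding \<tau> (compose (carrier M) g h) M P"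
proof (rule embeddingI)
  have hM: "h \<in> carrier M \<rightarrow> carrier N" and gN: "g \<in> carrier N \<rightarrow> carrier P"
    using embeddingD(3)[OF h] embeddingD(3)[OF g] by auto
  show "inj_on (compose (carrier M) g h) (carrier M)"
    using embeddingD(4)[OF h] embeddingD(4)[OF g] hM by (auto simp: compose_def inj_on_def Pi_def)
  show "compose (carrier M) g h \<in> carrier M \<rightarrow>\<^sub>E carrier P"
    using gN embeddingD(3)[OF h] by (rule compose_PiE)
  fix f t assume f: "f \<in> funs \<tau>" and t: "t \<in> fun_arity \<tau> f \<rightarrow>\<^sub>E carrier M"
  show "compose (carrier M) g h (fun_interp M f t)
      = fun_interp P f (compose (fun_arity \<tau> f) (compose (carrier M) g h) t)"
    using fun_interp_carrier[OF embeddingD(1)[OF h] f t] embeddingD(6)[OF h f t]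
      embeddingD(6)[OF g f compose_PiE[OF hM t]] by (simp add: compose_assoc_PiE[OF t] compose_eq)
next
  fix R t assume R: "R \<in> rels \<tau>" and t: "t \<in> rel_arity \<tau> R \<rightarrow>\<^sub>E carrier M"
  have "h \<in> carrier M \<rightarrow> carrier N" using embeddingD(5)[OF h] by blast
  then show "t \<in> rel_interp M R \<longleftrightarrow>
      compose (rel_arity \<tau> R) (compose (carrier M) g h) t \<in> rel_interp P R"
    using embeddingD(7)[OF h R t] embeddingD(7)[OF g R compose_PiE[OF _ t]]
    by (simp add: compose_assoc_PiE[OF t])
qed (use embeddingD(1)[OF h] embeddingD(2)[OF g] in simp_all)

lemma embedding_corestrict:
  fixes \<tau> :: "'u vocabulary"
  assumes "embedding \<tau> h M N" "substructure \<tau> N' N" "h ` carrier M \<subseteq> carrier N'"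
  shows "embedding \<tau> h M N'"
proof -
  have h: "h \<in> carrier M \<rightarrow> carrier N'" using assms(3) by auto
  have "compose X h t \<in> X \<rightarrow>\<^sub>E carrier N'" if "t \<in> X \<rightarrow>\<^sub>E carrier M" for X and t :: "'u \<Rightarrow> 'u"
    using compose_PiE[OF h that] .
  moreover have "h \<in> carrier M \<rightarrow>\<^sub>E carrier N'"
    using h assms(1) by (auto simp: embedding_iff extensional_funcset_def)
  ultimately show ?thesis
    using assms(1,2) unfolding embedding_iff substructure_def by simp
qed

lemma struct_iso_inverse_embedding:
  fixes \<tau> :: "'u vocabulary"
  assumes iso: "struct_iso \<tau> h M N"
  shows "embedding \<tau> (\<lambda>y\<in>carrier N. inv_into (carrier M) h y) N M" (is "embedding \<tau> ?g N M")
proof (rule embeddingI)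
  show M: "is_struct \<tau> M" and N: "is_struct \<tau> N" using iso by (simp_all add: struct_iso_def)
  have bij: "bij_betw h (carrier M) (carrier N)" using iso by (simp add: struct_iso_def)
  show g: "?g \<in> carrier N \<rightarrow>\<^sub>E carrier M" using bij by (auto simp: bij_betw_def inv_into_into)
  have hg: "h (?g y) = y" if "y \<in> carrier N" for y
    using that bij by (simp add: bij_betw_inv_into_right)
  show "inj_on ?g (carrier N)" by (metis hg inj_onI)
  have gt: "compose X ?g t \<in> X \<rightarrow>\<^sub>E carrier M" if "t \<in> X \<rightarrow>\<^sub>E carrier N" for X and t :: "'u \<Rightarrow> 'u"
    by (rule compose_PiE[OF _ that]) (use g in auto)
  have hgt: "compose X h (compose X ?g t) = t" if "t \<in> X \<rightarrow>\<^sub>E carrier N" for X and t :: "'u \<Rightarrow> 'u"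
    using that hg PiE_mem[OF that]
    by (intro extensionalityI[of _ X]) (auto simp: compose_eq extensional_funcset_def)
  show "?g (fun_interp N f t) = fun_interp M f (compose (fun_arity \<tau> f) ?g t)"
    if f: "f \<in> funs \<tau>" and t: "t \<in> fun_arity \<tau> f \<rightarrow>\<^sub>E carrier N" for f t
  proof -
    have "h (fun_interp M f (compose (fun_arity \<tau> f) ?g t)) = fun_interp N f t"
      using iso f gt[OF t] hgt[OF t] by (simp add: struct_iso_def)
    then show ?thesis
      using bij_betw_inv_into_left[OF bij fun_interp_carrier[OF M f gt[OF t]]]
        fun_interp_carrier[OF N f t] by simp
  qed
  show "t \<in> rel_interp N R \<longleftrightarrow> compose (rel_arity \<tau> R) ?g t \<in> rel_interp M R"
    if "R \<in> rels \<tau>" "t \<in> rel_arity \<tau> R \<rightarrow>\<^sub>E carrier N" for R t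
    using iso gt[OF that(2)] hgt[OF that(2)] that(1) by (simp add: struct_iso_def)
qed

lemma substructure_directed_UN_image:
  fixes I :: "'u set" and D :: "'u \<Rightarrow> 'u struct"
  assumes \<tau>: "is_vocabulary \<mu> \<tau>" and dir: "directed_poset \<mu> I r" and X: "is_struct \<tau> X"
    and emb: "\<And>i. i \<in> I \<Longrightarrow> embedding \<tau> (e i) (D i) X"
    and mono: "\<And>i j. (i, j) \<in> r \<Longrightarrow> e i ` carrier (D i) \<subseteq> e j ` carrier (D j)"
  shows "substructure \<tau> (restrict_struct \<tau> X (\<Union>i\<in>I. e i ` carrier (D i))) X"
proof (rule substructure_restrict_struct[OF X])
  show "(\<Union>i\<in>I. e i ` carrier (D i)) \<subseteq> carrier X" using embeddingD(5)[OF emb] by blast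
  fix f t assume f: "f \<in> funs \<tau>" and t: "t \<in> fun_arity \<tau> f \<rightarrow>\<^sub>E (\<Union>i\<in>I. e i ` carrier (D i))"
  have small: "|fun_arity \<tau> f| <o \<mu>" using \<tau> f by (simp add: is_vocabulary_def)
  obtain i where i: "i \<in> I" and ti: "t \<in> fun_arity \<tau> f \<rightarrow>\<^sub>E e i ` carrier (D i)"
    by (rule directed_UN_PiE[where B = "\<lambda>i. e i ` carrier (D i)", OF dir mono small t])
  have "fun_interp X f t \<in> e i ` carrier (D i)"
    by (rule fun_interp_image_closed[OF embeddingD(1)[OF emb[OF i]] f
          embeddingD(6)[OF emb[OF i] f] ti])
  then show "fun_interp X f t \<in> (\<Union>i\<in>I. e i ` carrier (D i))" using i by blast
qed


section \<open>Unions and universal classes\<close>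

lemma carrier_struct_union [simp]: "carrier (struct_union \<tau> I M) = (\<Union>i\<in>I. carrier (M i))"
  by (simp add: struct_union_def)

lemma rel_interp_struct_union [simp]:
  "rel_interp (struct_union \<tau> I M) R = (\<Union>i\<in>I. rel_interp (M i) R)"
  by (simp add: struct_union_def)

context
  fixes \<mu> :: "'u rel" and \<tau> :: "'u vocabulary" and I :: "'u set" and r :: "'u rel"
    and M :: "'u \<Rightarrow> 'u struct"
  assumes \<mu>: "regular_cardinal \<mu>" and \<tau>: "is_vocabulary \<mu> \<tau>" and dir: "directed_poset \<mu> I r"
    and struct: "\<And>i. i \<in> I \<Longrightarrow> is_struct \<tau> (M i)"
    and sub: "\<And>i j. (i, j) \<in> r \<Longrightarrow> substructure \<tau> (M i) (M j)"
begin

lemma carrier_directed_mono: "(i, j) \<in> r \<Longrightarrow> carrier (M i) \<subseteq> carrier (M j)"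
  using sub by (simp add: substructure_def)

lemma fun_interp_struct_union:
  assumes i: "i \<in> I" and f: "f \<in> funs \<tau>" and t: "t \<in> fun_arity \<tau> f \<rightarrow>\<^sub>E carrier (M i)"
  shows "fun_interp (struct_union \<tau> I M) f t = fun_interp (M i) f t"
proof -
  define j where "j = (SOME j. j \<in> I \<and> t \<in> fun_arity \<tau> f \<rightarrow>\<^sub>E carrier (M j))"
  have j: "j \<in> I" "t \<in> fun_arity \<tau> f \<rightarrow>\<^sub>E carrier (M j)"
    using someI[of "\<lambda>j. j \<in> I \<and> t \<in> fun_arity \<tau> f \<rightarrow>\<^sub>E carrier (M j)" i] i t by (auto simp: j_def)
  obtain k where "(i, k) \<in> r" "(j, k) \<in> r"
    using directed_poset_bound_pair[OF \<mu> dir i j(1)] by metis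
  then have "substructure \<tau> (M i) (M k)" "substructure \<tau> (M j) (M k)" using sub by auto
  then have "fun_interp (M j) f t = fun_interp (M i) f t" using f t j(2) by (simp add: substructure_def)
  moreover have "t \<in> fun_arity \<tau> f \<rightarrow>\<^sub>E (\<Union>i\<in>I. carrier (M i))" using t i by (auto simp: PiE_iff)
  ultimately show ?thesis using f by (simp add: struct_union_def j_def)
qed

lemma is_struct_struct_union:
  assumes "regular_universe TYPE('u)"
  shows "is_struct \<tau> (struct_union \<tau> I M)" (is "is_struct \<tau> ?N")
  unfolding is_struct_def
proof (intro conjI ballI allI impI)
  show "small TYPE('u) (carrier ?N)"
    unfolding carrier_struct_union using directed_poset_small[OF dir] struct_small[OF struct]
    by (intro small_UNION[OF assms])
  have "fun_interp ?N f t \<in> carrier ?N"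
    if f: "f \<in> funs \<tau>" and t: "t \<in> fun_arity \<tau> f \<rightarrow>\<^sub>E carrier ?N" for f t
  proof -
    have small: "|fun_arity \<tau> f| <o \<mu>" using \<tau> f by (simp add: is_vocabulary_def)
    obtain i where i: "i \<in> I" "t \<in> fun_arity \<tau> f \<rightarrow>\<^sub>E carrier (M i)"
      by (rule directed_UN_PiE[where B = "\<lambda>i. carrier (M i)",
            OF dir carrier_directed_mono small t[unfolded carrier_struct_union]])
    then show ?thesis
      using fun_interp_struct_union[OF i(1) f i(2)] fun_interp_carrier[OF struct[OF i(1)] f i(2)]
      by auto
  qed
  moreover have "fun_interp ?N f t = undefined"
    if "f \<in> funs \<tau>" "t \<notin> fun_arity \<tau> f \<rightarrow>\<^sub>E carrier ?N" for f t
    using that unfolding carrier_struct_union by (simp add: struct_union_def)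
  moreover have "fun_interp ?N f = undefined" if "f \<notin> funs \<tau>" for f
    using that by (simp add: struct_union_def)
  ultimately show "fun_interp ?N \<in> (\<Pi>\<^sub>E f \<in> funs \<tau>. (fun_arity \<tau> f \<rightarrow>\<^sub>E carrier ?N) \<rightarrow>\<^sub>E carrier ?N)"
    by (intro PiE_I)
  show "rel_interp ?N R \<subseteq> rel_arity \<tau> R \<rightarrow>\<^sub>E carrier ?N" if R: "R \<in> rels \<tau>" for R
  proof
    fix t assume "t \<in> rel_interp ?N R"
    then obtain i where i: "i \<in> I" "t \<in> rel_interp (M i) R" by auto
    then have "t \<in> rel_arity \<tau> R \<rightarrow>\<^sub>E carrier (M i)" using rel_interp_PiE[OF struct R] by blast
    then show "t \<in> rel_arity \<tau> R \<rightarrow>\<^sub>E carrier ?N" using i(1) by (auto simp: PiE_iff)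
  qed
  show "rel_interp ?N R = {}" if "R \<notin> rels \<tau>" for R
    using that struct by (auto simp: is_struct_def)
qed

lemma substructure_struct_union:
  assumes U: "regular_universe TYPE('u)" and i: "i \<in> I"
  shows "substructure \<tau> (M i) (struct_union \<tau> I M)"
proof -
  have "rel_interp (M i) R = rel_interp (struct_union \<tau> I M) R \<inter> (rel_arity \<tau> R \<rightarrow>\<^sub>E carrier (M i))"
    if R: "R \<in> rels \<tau>" for R
  proof
    show "rel_interp (M i) R \<subseteq> rel_interp (struct_union \<tau> I M) R \<inter> (rel_arity \<tau> R \<rightarrow>\<^sub>E carrier (M i))"
      using i rel_interp_PiE[OF struct[OF i] R] by auto
    show "rel_interp (struct_union \<tau> I M) R \<inter> (rel_arity \<tau> R \<rightarrow>\<^sub>E carrier (M i)) \<subseteq> rel_interp (M i) R"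
    proof
      fix t assume t: "t \<in> rel_interp (struct_union \<tau> I M) R \<inter> (rel_arity \<tau> R \<rightarrow>\<^sub>E carrier (M i))"
      then obtain j where j: "j \<in> I" "t \<in> rel_interp (M j) R" by auto
      obtain k where "(i, k) \<in> r" "(j, k) \<in> r"
        using directed_poset_bound_pair[OF \<mu> dir i j(1)] by metis
      then have "substructure \<tau> (M i) (M k)" "substructure \<tau> (M j) (M k)" using sub by auto
      then show "t \<in> rel_interp (M i) R" using t j R by (auto simp: substructure_def)
    qed
  qed
  then show ?thesis
    using struct[OF i] is_struct_struct_union[OF U] fun_interp_struct_union[OF i] i
    by (auto simp: substructure_def)
qed

end

lemma universal_AECI_local:
  fixes L :: "'u struct set"
  assumes U: "regular_universe TYPE('u)" and \<mu>: "regular_cardinal \<mu>" and \<tau>: "is_vocabulary \<mu> \<tau>"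
    and struct: "\<And>M. M \<in> L \<Longrightarrow> is_struct \<tau> M"
    and embed: "\<And>h M N. embedding \<tau> h M N \<Longrightarrow> N \<in> L \<Longrightarrow> M \<in> L"
    and local: "\<And>N. is_struct \<tau> N \<Longrightarrow>
      (\<And>A. A \<subseteq> carrier N \<Longrightarrow> |A| <o \<mu> \<Longrightarrow> \<exists>M\<in>L. substructure \<tau> M N \<and> A \<subseteq> carrier M) \<Longrightarrow> N \<in> L"
  shows "universal_AEC \<mu> \<tau> L"
  unfolding universal_AEC_def
proof (intro conjI ballI allI impI)
  show "N \<in> L" if "M \<in> L" "struct_iso \<tau> h M N" for M N h
    using embed[OF struct_iso_inverse_embedding[OF that(2)] that(1)] .
  show "M \<in> L" if "N \<in> L" "substructure \<tau> M N" for M N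
    using embed[OF substructure_embedding[OF that(2)] that(1)] .
  fix I r and M :: "'u \<Rightarrow> 'u struct"
  assume dir: "directed_poset \<mu> I r" and M: "\<forall>i\<in>I. M i \<in> L"
    and "\<forall>(i, j)\<in>r. substructure \<tau> (M i) (M j)"
  then have sub: "substructure \<tau> (M i) (M j)" if "(i, j) \<in> r" for i j using that by auto
  have structM: "is_struct \<tau> (M i)" if "i \<in> I" for i using struct M that by blast
  show "struct_union \<tau> I M \<in> L"
  proof (rule local)
    show "is_struct \<tau> (struct_union \<tau> I M)"
      by (rule is_struct_struct_union[OF \<mu> \<tau> dir structM sub U])
    fix A assume A: "A \<subseteq> carrier (struct_union \<tau> I M)" "|A| <o \<mu>"
    have mono: "carrier (M i) \<subseteq> carrier (M j)" if "(i, j) \<in> r" for i j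
      using sub[OF that] by (simp add: substructure_def)
    obtain i where i: "i \<in> I" "A \<subseteq> carrier (M i)"
      by (rule directed_UN_subset[where B = "\<lambda>i. carrier (M i)",
            OF dir mono A(1)[unfolded carrier_struct_union] A(2)])
    have "substructure \<tau> (M i) (struct_union \<tau> I M)"
      by (rule substructure_struct_union[OF \<mu> \<tau> dir structM sub U i(1)])
    then show "\<exists>W\<in>L. substructure \<tau> W (struct_union \<tau> I M) \<and> A \<subseteq> carrier W"
      using M i by blast
  qed
qed (use \<tau> struct in auto)

lemma universal_AECD:
  assumes "universal_AEC \<mu> \<tau> L"
  shows "is_vocabulary \<mu> \<tau>" "M \<in> L \<Longrightarrow> is_struct \<tau> M" "N \<in> L \<Longrightarrow> substructure \<tau> M N \<Longrightarrow> M \<in> L"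
  using assms unfolding universal_AEC_def by (elim conjE, blast)+

lemma universal_AEC_mono:
  assumes L: "universal_AEC \<nu> \<tau> L" and le: "\<nu> \<le>o \<mu>"
  shows "universal_AEC \<mu> \<tau> L"
proof -
  have "is_vocabulary \<mu> \<tau>"
    using L ordLess_ordLeq_trans[OF _ le] by (auto simp: universal_AEC_def is_vocabulary_def)
  moreover have "struct_union \<tau> I M \<in> L" if "directed_poset \<mu> I r" "\<forall>i \<in> I. M i \<in> L"
      "\<forall>(i, j) \<in> r. substructure \<tau> (M i) (M j)" for I r M
    using L directed_poset_mono[OF that(1) le] that(2,3) unfolding universal_AEC_def by blast
  ultimately show ?thesis
    using L unfolding universal_AEC_def by blast
qed


section \<open>Colimits in a universal class\<close>

abbreviation underlying :: "'s \<times> ('u \<Rightarrow> 'u) \<times> 's \<Rightarrow> 'u \<Rightarrow> 'u" where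
  "underlying a \<equiv> fst (snd a)"

lemma AEC_cat_simps [simp]:
  "Obj (AEC_cat \<tau> L) = L" "idt (AEC_cat \<tau> L) M = (M, \<lambda>x\<in>carrier M. x, M)"
  "cmp (AEC_cat \<tau> L) (N, g, P) (M, f, N') = (M, compose (carrier M) g f, P)"
  by (simp_all add: AEC_cat_def)

lemma hom_AEC_cat:
  "hom (AEC_cat \<tau> L) M N = {(M, h, N) | h. M \<in> L \<and> N \<in> L \<and> embedding \<tau> h M N}"
  by (auto simp: AEC_cat_def hom_def)

lemma hom_AEC_catD:
  assumes "a \<in> hom (AEC_cat \<tau> L) M N"
  shows "M \<in> L" "N \<in> L" "embedding \<tau> (underlying a) M N" "a = (M, underlying a, N)"
  using assms by (auto simp: hom_AEC_cat)

lemma underlying_carrier: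
  "a \<in> hom (AEC_cat \<tau> L) M N \<Longrightarrow> x \<in> carrier M \<Longrightarrow> underlying a x \<in> carrier N"
  by (rule embeddingD(5)[OF hom_AEC_catD(3)])

lemma underlying_cmp:
  assumes "a \<in> hom (AEC_cat \<tau> L) M N" "b \<in> hom (AEC_cat \<tau> L) N P" "x \<in> carrier M"
  shows "underlying (cmp (AEC_cat \<tau> L) b a) x = underlying b (underlying a x)"
  using assms by (auto simp: hom_AEC_cat compose_eq)

lemma hom_AEC_cat_eqI:
  assumes a: "a \<in> hom (AEC_cat \<tau> L) M N" and b: "b \<in> hom (AEC_cat \<tau> L) M N"
    and eq: "\<And>x. x \<in> carrier M \<Longrightarrow> underlying a x = underlying b x"
  shows "a = b"
proof -
  have "underlying a \<in> extensional (carrier M)" "underlying b \<in> extensional (carrier M)"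
    using embeddingD(3)[OF hom_AEC_catD(3)[OF a]] embeddingD(3)[OF hom_AEC_catD(3)[OF b]]
    by (auto simp: extensional_funcset_def)
  then have "underlying a = underlying b" using eq by (rule extensionalityI)
  then show ?thesis using hom_AEC_catD(4)[OF a] hom_AEC_catD(4)[OF b] by metis
qed

lemma category_AEC_cat:
  assumes struct: "\<And>M. M \<in> L \<Longrightarrow> is_struct \<tau> M"
  shows "category (AEC_cat \<tau> L)" (is "category ?A")
proof
  show id: "idt ?A M \<in> hom ?A M M" if "M \<in> Obj ?A" for M
    using that struct by (auto simp: hom_AEC_cat embedding_id)
  show cmp: "cmp ?A b a \<in> hom ?A M P" if "a \<in> hom ?A M N" "b \<in> hom ?A N P" for a b M N P
    using that by (auto simp: hom_AEC_cat embedding_compose)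
  show "cmp ?A a (idt ?A M) = a" if a: "a \<in> hom ?A M N" for a M N
  proof (rule hom_AEC_cat_eqI[OF cmp[OF id a] a])
    show "underlying (cmp ?A a (idt ?A M)) x = underlying a x" if "x \<in> carrier M" for x
      using underlying_cmp[OF id a that] hom_AEC_catD(1)[OF a] that by simp
  qed (use hom_AEC_catD(1)[OF a] in simp)
  show "cmp ?A (idt ?A N) a = a" if a: "a \<in> hom ?A M N" for a M N
  proof (rule hom_AEC_cat_eqI[OF cmp[OF a id] a])
    show "underlying (cmp ?A (idt ?A N) a) x = underlying a x" if "x \<in> carrier M" for x
      using underlying_cmp[OF a id that] hom_AEC_catD(2)[OF a] underlying_carrier[OF a that] by simp
  qed (use hom_AEC_catD(2)[OF a] in simp)
  show "cmp ?A d (cmp ?A b a) = cmp ?A (cmp ?A d b) a"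
    if a: "a \<in> hom ?A M N" and b: "b \<in> hom ?A N P" and d: "d \<in> hom ?A P Q" for a b d M N P Q
  proof (rule hom_AEC_cat_eqI[OF cmp[OF cmp[OF a b] d] cmp[OF a cmp[OF b d]]])
    show "underlying (cmp ?A d (cmp ?A b a)) x = underlying (cmp ?A (cmp ?A d b) a) x"
      if x: "x \<in> carrier M" for x
      using underlying_cmp[OF cmp[OF a b] d x] underlying_cmp[OF a b x]
        underlying_cmp[OF a cmp[OF b d] x] underlying_cmp[OF b d underlying_carrier[OF a x]] by simp
  qed
qed (auto simp: AEC_cat_def)

lemma AEC_cocone_apply:
  assumes G: "is_functor (poset_cat I r) (AEC_cat \<tau> L) G"
    and c: "is_cocone (poset_cat I r) (AEC_cat \<tau> L) G X c"
    and ij: "(i, j) \<in> r" and x: "x \<in> carrier (omap G i)"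
  shows "underlying (c j) (underlying (amap G (i, j)) x) = underlying (c i) x"
  using underlying_cmp[OF functor_poset_catD(2)[OF G ij]
      cocone_poset_catD(2)[OF c functor_poset_catD(6)[OF G ij]] x] cocone_poset_catD(3)[OF c ij] by simp

lemma AEC_cocone_image_mono:
  assumes G: "is_functor (poset_cat I r) (AEC_cat \<tau> L) G"
    and c: "is_cocone (poset_cat I r) (AEC_cat \<tau> L) G X c" and ij: "(i, j) \<in> r"
  shows "underlying (c i) ` carrier (omap G i) \<subseteq> underlying (c j) ` carrier (omap G j)"
proof
  fix y assume "y \<in> underlying (c i) ` carrier (omap G i)"
  then obtain x where x: "x \<in> carrier (omap G i)" "y = underlying (c i) x" by blast
  then show "y \<in> underlying (c j) ` carrier (omap G j)"
    using AEC_cocone_apply[OF G c ij x(1)] underlying_carrier[OF functor_poset_catD(2)[OF G ij] x(1)]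
    by (metis image_eqI)
qed

lemma AEC_cocone_corestrict:
  assumes G: "is_functor (poset_cat I r) (AEC_cat \<tau> L) G"
    and c: "is_cocone (poset_cat I r) (AEC_cat \<tau> L) G X c"
    and W: "substructure \<tau> W X" "W \<in> L"
    and image: "\<And>i. i \<in> I \<Longrightarrow> underlying (c i) ` carrier (omap G i) \<subseteq> carrier W"
  shows "is_cocone (poset_cat I r) (AEC_cat \<tau> L) G W (\<lambda>i. (omap G i, underlying (c i), W))"
  unfolding is_cocone_poset_cat
proof (intro conjI ballI)
  let ?A = "AEC_cat \<tau> L" and ?d = "\<lambda>i. (omap G i, underlying (c i), W)"
  interpret G: is_functor "poset_cat I r" ?A G by fact
  show d: "?d i \<in> hom ?A (omap G i) W" if "i \<in> I" for i
    using embedding_corestrict[OF _ W(1) image[OF that]] hom_AEC_catD[OF cocone_poset_catD(2)[OF c that]]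
      W(2) by (simp add: hom_AEC_cat)
  show "case p of (i, j) \<Rightarrow> cmp ?A (?d j) (amap G (i, j)) = ?d i" if p: "p \<in> r" for p
  proof -
    obtain i j where ij: "p = (i, j)" "(i, j) \<in> r" using p by (cases p) simp
    note I = functor_poset_catD(5,6)[OF G ij(2)] and g = functor_poset_catD(2)[OF G ij(2)]
    have "cmp ?A (?d j) (amap G (i, j)) = ?d i"
    proof (rule hom_AEC_cat_eqI[OF G.D.cmp_hom[OF g d[OF I(2)]] d[OF I(1)]])
      show "underlying (cmp ?A (?d j) (amap G (i, j))) x = underlying (?d i) x"
        if "x \<in> carrier (omap G i)" for x
        using underlying_cmp[OF g d[OF I(2)] that] AEC_cocone_apply[OF G c ij(2) that] by simp
    qed
    then show ?thesis by (simp add: ij(1))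
  qed
qed (use W(2) in simp)

lemma AEC_colimit_jointly_surjective:
  assumes L: "universal_AEC \<mu> \<tau> L" and dir: "directed_poset \<mu> I r"
    and G: "is_functor (poset_cat I r) (AEC_cat \<tau> L) G"
    and colim: "is_colimit (poset_cat I r) (AEC_cat \<tau> L) G X c"
  shows "carrier X = (\<Union>i\<in>I. underlying (c i) ` carrier (omap G i))" (is "_ = ?V")
proof
  let ?A = "AEC_cat \<tau> L" and ?W = "restrict_struct \<tau> X ?V"
  interpret G: is_functor "poset_cat I r" ?A G by fact
  note cocone = colimit_is_cocone[OF colim]
  have X: "X \<in> L" using cocone_poset_catD(1)[OF cocone] by simp
  have c: "c i \<in> hom ?A (omap G i) X" if "i \<in> I" for i using cocone_poset_catD(2)[OF cocone that] .
  show "?V \<subseteq> carrier X" using underlying_carrier[OF c] by blast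
  have sub: "substructure \<tau> ?W X"
    by (rule substructure_directed_UN_image[OF universal_AECD(1)[OF L] dir universal_AECD(2)[OF L X]
          hom_AEC_catD(3)[OF c]
          AEC_cocone_image_mono[OF G cocone]])
  have W: "?W \<in> L" using universal_AECD(3)[OF L X sub] .
  let ?d = "\<lambda>i. (omap G i, underlying (c i), ?W)" and ?incl = "(?W, \<lambda>x\<in>?V. x, X)"
  have d: "is_cocone (poset_cat I r) ?A G ?W ?d"
    by (rule AEC_cocone_corestrict[OF G cocone sub W]) auto
  obtain h where h: "h \<in> hom ?A X ?W" "\<And>i. i \<in> I \<Longrightarrow> cmp ?A h (c i) = ?d i"
    using colimit_poset_cat_factor[OF colim d] by blast
  have incl: "?incl \<in> hom ?A ?W X"
    using substructure_embedding[OF sub] W X by (simp add: hom_AEC_cat)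
  have "cmp ?A ?incl h = idt ?A X"
  proof (rule colimit_endomorphism_eq_idt[OF G colim G.D.cmp_hom[OF h(1) incl]])
    fix i assume "i \<in> Obj (poset_cat I r)"
    then have i: "i \<in> I" by simp
    have di: "?d i \<in> hom ?A (omap G i) ?W" using cocone_poset_catD(2)[OF d i] .
    have "cmp ?A ?incl (?d i) = c i"
    proof (rule hom_AEC_cat_eqI[OF G.D.cmp_hom[OF di incl] c[OF i]])
      show "underlying (cmp ?A ?incl (?d i)) x = underlying (c i) x" if "x \<in> carrier (omap G i)" for x
        using underlying_cmp[OF di incl that] i that by auto
    qed
    then show "cmp ?A (cmp ?A ?incl h) (c i) = c i"
      using G.D.cmp_assoc[OF c[OF i] h(1) incl] h(2)[OF i] by simp
  qed
  then have "underlying h x = x" if "x \<in> carrier X" for x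
    using underlying_cmp[OF h(1) incl that] underlying_carrier[OF h(1) that] that by simp
  then show "carrier X \<subseteq> ?V" using underlying_carrier[OF h(1)] by force
qed


section \<open>The class of structured diagrams\<close>

locale structured_diagrams = category K for K :: "('o, 'm) cat" +
  fixes \<nu> :: "'u rel" and S :: "'o set"
  assumes universe: "regular_universe TYPE('u)"
    and regular: "regular_cardinal \<nu>"
    and locally_small: "locally_small TYPE('u) K"
    and S_small: "small TYPE('u) S"
    and S_Obj: "S \<subseteq> Obj K"
begin

definition arrs :: "'m set" where
  "arrs = {f \<in> Arr K. src K f \<in> S \<and> trg K f \<in> S}"

definition arrow_symbol :: "'m \<Rightarrow> 'u" where
  "arrow_symbol = (SOME c. inj_on c arrs)"

definition places :: "'u \<times> 'u" where
  "places = (SOME p. fst p \<noteq> snd p)"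

definition pair_arity :: "'u set" where
  "pair_arity = {fst places, snd places}"

definition pair :: "'u \<Rightarrow> 'u \<Rightarrow> 'u \<Rightarrow> 'u" where
  "pair x y = (\<lambda>p \<in> pair_arity. if p = fst places then x else y)"

text \<open>The function symbol \<open>\<alpha>\<close> chooses upper bounds of families indexed by the initial segment
  below \<open>\<alpha>\<close>; these segments exhaust the cardinalities below \<open>\<nu>\<close>. The relation symbol
  of an arrow \<open>f\<close> of \<open>S\<close> holds of \<open>(x, y)\<close> when \<open>x \<le> y\<close> and the diagram takes
  this edge to \<open>f\<close>.\<close>

definition voc :: "'u vocabulary" where
  "voc = \<lparr>funs = Field \<nu>, rels = arrow_symbol ` arrs, fun_arity = underS \<nu>,
    rel_arity = (\<lambda>_. pair_arity)\<rparr>"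

definition edge :: "'u struct \<Rightarrow> 'm \<Rightarrow> 'u \<Rightarrow> 'u \<Rightarrow> bool" where
  "edge M f x y \<longleftrightarrow> pair x y \<in> rel_interp M (arrow_symbol f)"

definition chooses_bound :: "'u struct \<Rightarrow> 'u \<Rightarrow> ('u \<Rightarrow> 'u) \<Rightarrow> bool" where
  "chooses_bound M \<alpha> t \<longleftrightarrow> (\<forall>z \<in> underS \<nu> \<alpha>. \<exists>f\<in>arrs. edge M f (t z) (fun_interp M \<alpha> t))"

text \<open>The last conjunct of \<open>diagram_axioms\<close> says, all arrows being monic, that distinct elements
  of the same sort have distinct colimit legs; it makes the colimit functor faithful.\<close>

definition diagram_axioms :: "'u struct \<Rightarrow> 'u \<Rightarrow> 'u \<Rightarrow> 'u \<Rightarrow> bool" where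
  "diagram_axioms M x y z \<longleftrightarrow>
    (\<exists>s\<in>S. edge M (idt K s) x x) \<and>
    (\<forall>f\<in>arrs. \<forall>g\<in>arrs. edge M f x y \<longrightarrow> edge M g y z \<longrightarrow>
      trg K f = src K g \<and> edge M (cmp K g f) x z) \<and>
    (\<forall>f\<in>arrs. \<forall>g\<in>arrs. edge M f x y \<longrightarrow> edge M g x y \<longrightarrow> f = g) \<and>
    (\<forall>f\<in>arrs. \<forall>g\<in>arrs. edge M f x y \<longrightarrow> edge M g y x \<longrightarrow> x = y) \<and>
    (\<forall>f\<in>arrs. edge M f x z \<longrightarrow> edge M f y z \<longrightarrow> x = y)"

definition diagrams :: "'u struct set" where
  "diagrams = {M. is_struct voc M \<and>
    (\<forall>x\<in>carrier M. \<forall>y\<in>carrier M. \<forall>z\<in>carrier M. diagram_axioms M x y z) \<and>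
    (\<forall>\<alpha>\<in>Field \<nu>. \<forall>t \<in> underS \<nu> \<alpha> \<rightarrow>\<^sub>E carrier M. chooses_bound M \<alpha> t)}"

abbreviation diagram_cat :: "('u struct, 'u struct \<times> ('u \<Rightarrow> 'u) \<times> 'u struct) cat" where
  "diagram_cat \<equiv> AEC_cat voc diagrams"

lemma voc_simps [simp]:
  "funs voc = Field \<nu>" "rels voc = arrow_symbol ` arrs" "fun_arity voc = underS \<nu>"
  "rel_arity voc R = pair_arity"
  by (simp_all add: voc_def)

lemma hom_arrs: "f \<in> hom K s s' \<Longrightarrow> s \<in> S \<Longrightarrow> s' \<in> S \<Longrightarrow> f \<in> arrs"
  by (simp add: arrs_def hom_def)

lemma arrs_hom: "f \<in> arrs \<Longrightarrow> f \<in> hom K (src K f) (trg K f)"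
  by (simp add: arrs_def hom_def)

lemma idt_arrs: "s \<in> S \<Longrightarrow> idt K s \<in> arrs"
  using idt_hom S_Obj hom_arrs by blast

lemma cmp_arrs: "f \<in> arrs \<Longrightarrow> g \<in> arrs \<Longrightarrow> trg K f = src K g \<Longrightarrow> cmp K g f \<in> arrs"
  using cmp_hom[of f "src K f" "trg K f" g "trg K g"] by (auto simp: arrs_def hom_def)

lemma arrs_small: "small TYPE('u) arrs"
proof -
  have "small TYPE('u) (\<Union>s\<in>S. \<Union>s'\<in>S. hom K s s')"
    using S_small S_Obj locally_small
    by (intro small_UNION[OF universe]) (auto simp: locally_small_def)
  then show ?thesis by (rule small_subset) (auto simp: arrs_def hom_def)
qed

lemma inj_arrow_symbol: "inj_on arrow_symbol arrs"
proof -
  have "|arrs| \<le>o |UNIV :: 'u set|"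
    using arrs_small by (simp add: small_def ordLess_imp_ordLeq)
  then obtain c :: "'m \<Rightarrow> 'u" where "inj_on c arrs"
    using card_of_ordLeq[of arrs "UNIV :: 'u set"] by blast
  then show ?thesis unfolding arrow_symbol_def by (rule someI[where P = "\<lambda>c. inj_on c arrs"])
qed

lemma places_distinct: "fst places \<noteq> snd places"
proof -
  have "infinite (UNIV :: 'u set)" using universe by (simp add: regular_universe_def)
  then obtain a b :: 'u where "a \<noteq> b"
    by (metis ex_new_if_finite finite.emptyI finite_insert insertI1)
  then have "fst (a, b) \<noteq> snd (a, b)" by simp
  then show ?thesis unfolding places_def by (rule someI[where P = "\<lambda>p. fst p \<noteq> snd p"])
qed

lemma pair_apply: "pair x y (fst places) = x" "pair x y (snd places) = y"
  using places_distinct by (simp_all add: pair_def pair_arity_def)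

lemma pair_eq_iff: "pair x y = pair x' y' \<longleftrightarrow> x = x' \<and> y = y'"
  by (metis pair_apply)

lemma pair_PiE_iff: "pair x y \<in> pair_arity \<rightarrow>\<^sub>E A \<longleftrightarrow> x \<in> A \<and> y \<in> A"
  using pair_apply[of x y]
  by (auto simp: PiE_iff pair_arity_def) (simp add: pair_def pair_arity_def)

lemma compose_pair: "compose pair_arity h (pair x y) = pair (h x) (h y)"
  unfolding compose_def pair_def by (intro restrict_ext) auto

lemma is_vocabulary_voc: "is_vocabulary \<nu> voc"
proof -
  have "|Field \<nu>| <o |UNIV :: 'u set|"
    using regular card_of_Field_ordIso ordIso_ordLess_trans unfolding regular_cardinal_def by blast
  moreover have "|arrow_symbol ` arrs| <o |UNIV :: 'u set|"
    using arrs_small unfolding small_def by (rule card_of_image_ordLess)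
  moreover have "|pair_arity| <o \<nu>"
    by (rule finite_ordLess_regular_cardinal[OF regular]) (simp add: pair_arity_def)
  ultimately show ?thesis
    using card_of_underS[OF regular_cardinal_Card_order[OF regular]]
    by (simp add: is_vocabulary_def small_def)
qed

lemma edge_carrier:
  assumes "is_struct voc M" "f \<in> arrs" "edge M f x y"
  shows "x \<in> carrier M" "y \<in> carrier M"
  using rel_interp_PiE[OF assms(1), of "arrow_symbol f" "pair x y"] assms(2,3)
  by (simp_all add: edge_def pair_PiE_iff)

lemma edge_embedding:
  assumes "embedding voc h M N" "f \<in> arrs" "x \<in> carrier M" "y \<in> carrier M"
  shows "edge M f x y \<longleftrightarrow> edge N f (h x) (h y)"
  using embeddingD(7)[OF assms(1), of "arrow_symbol f" "pair x y"] assms(2-4)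
  by (simp add: edge_def pair_PiE_iff compose_pair)

lemma diagram_axioms_embedding:
  assumes h: "embedding voc h M N" and x: "x \<in> carrier M" "y \<in> carrier M" "z \<in> carrier M"
  shows "diagram_axioms M x y z \<longleftrightarrow> diagram_axioms N (h x) (h y) (h z)"
proof -
  have inj: "h a = h b \<longleftrightarrow> a = b" if "a \<in> carrier M" "b \<in> carrier M" for a b
    using embeddingD(4)[OF h] that by (auto dest: inj_onD)
  note edge = edge_embedding[OF h]
  have edge_cmp: "(trg K f = src K g \<and> edge M (cmp K g f) x z) \<longleftrightarrow>
      (trg K f = src K g \<and> edge N (cmp K g f) (h x) (h z))" if "f \<in> arrs" "g \<in> arrs" for f g
    using edge[of "cmp K g f" x z] cmp_arrs[OF that] x by blast
  show ?thesis
    unfolding diagram_axioms_def using x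
    by (simp add: edge inj edge_cmp idt_arrs cong: bex_cong ball_cong)
qed

lemma chooses_bound_embedding:
  assumes h: "embedding voc h M N" and \<alpha>: "\<alpha> \<in> Field \<nu>" and t: "t \<in> underS \<nu> \<alpha> \<rightarrow>\<^sub>E carrier M"
  shows "chooses_bound M \<alpha> t \<longleftrightarrow> chooses_bound N \<alpha> (compose (underS \<nu> \<alpha>) h t)"
proof -
  have "h (fun_interp M \<alpha> t) = fun_interp N \<alpha> (compose (underS \<nu> \<alpha>) h t)"
    using embeddingD(6)[OF h] \<alpha> t by simp
  moreover have "fun_interp M \<alpha> t \<in> carrier M"
    using fun_interp_carrier[OF embeddingD(1)[OF h]] \<alpha> t by simp
  ultimately show ?thesis
    unfolding chooses_bound_def using edge_embedding[OF h] PiE_mem[OF t]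
    by (simp add: compose_def cong: ball_cong bex_cong)
qed

lemma diagrams_struct: "M \<in> diagrams \<Longrightarrow> is_struct voc M"
  by (simp add: diagrams_def)

lemma diagrams_embedding:
  assumes h: "embedding voc h M N" and N: "N \<in> diagrams"
  shows "M \<in> diagrams"
proof -
  have hM: "h \<in> carrier M \<rightarrow> carrier N" using embeddingD(5)[OF h] by blast
  have "diagram_axioms M x y z" if "x \<in> carrier M" "y \<in> carrier M" "z \<in> carrier M" for x y z
    using diagram_axioms_embedding[OF h that] N embeddingD(5)[OF h] that by (simp add: diagrams_def)
  moreover have "chooses_bound M \<alpha> t" if "\<alpha> \<in> Field \<nu>" "t \<in> underS \<nu> \<alpha> \<rightarrow>\<^sub>E carrier M" for \<alpha> t
    using chooses_bound_embedding[OF h that] compose_PiE[OF hM that(2)] N that(1)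
    by (simp add: diagrams_def)
  ultimately show ?thesis using embeddingD(1)[OF h] by (simp add: diagrams_def)
qed

lemma diagrams_local:
  assumes N: "is_struct voc N" and
    local: "\<And>A. A \<subseteq> carrier N \<Longrightarrow> |A| <o \<nu> \<Longrightarrow> \<exists>M\<in>diagrams. substructure voc M N \<and> A \<subseteq> carrier M"
  shows "N \<in> diagrams"
proof -
  have "diagram_axioms N x y z" if xyz: "x \<in> carrier N" "y \<in> carrier N" "z \<in> carrier N" for x y z
  proof -
    have small: "|{x, y, z}| <o \<nu>" by (rule finite_ordLess_regular_cardinal[OF regular]) simp
    have sub: "{x, y, z} \<subseteq> carrier N" using xyz by simp
    obtain M where M: "M \<in> diagrams" "substructure voc M N"
        "x \<in> carrier M" "y \<in> carrier M" "z \<in> carrier M"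
      using local[OF sub small] by blast
    then have "diagram_axioms M x y z" by (simp add: diagrams_def)
    then show ?thesis
      using diagram_axioms_embedding[OF substructure_embedding[OF M(2)] M(3-5)] M(3-5) by simp
  qed
  moreover have "chooses_bound N \<alpha> t" if \<alpha>: "\<alpha> \<in> Field \<nu>" and t: "t \<in> underS \<nu> \<alpha> \<rightarrow>\<^sub>E carrier N" for \<alpha> t
  proof -
    have small: "|t ` underS \<nu> \<alpha>| <o \<nu>"
      by (rule card_of_image_ordLess[OF card_of_underS[OF regular_cardinal_Card_order[OF regular] \<alpha>]])
    have sub: "t ` underS \<nu> \<alpha> \<subseteq> carrier N" using PiE_mem[OF t] by blast
    obtain M where M: "M \<in> diagrams" "substructure voc M N" "t ` underS \<nu> \<alpha> \<subseteq> carrier M"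
      using local[OF sub small] by blast
    have tM: "t \<in> underS \<nu> \<alpha> \<rightarrow>\<^sub>E carrier M" using t M(3) by (simp add: PiE_iff image_subset_iff)
    then have "chooses_bound M \<alpha> t" using M(1) \<alpha> by (simp add: diagrams_def)
    then show ?thesis
      using chooses_bound_embedding[OF substructure_embedding[OF M(2)] \<alpha> tM]
        Id_compose_PiE[OF tM] by simp
  qed
  ultimately show ?thesis using N by (simp add: diagrams_def)
qed

lemma universal_AEC_diagrams: "universal_AEC \<nu> voc diagrams"
  using universal_AECI_local[OF universe regular is_vocabulary_voc]
    diagrams_struct diagrams_embedding diagrams_local by metis

definition sort :: "'u struct \<Rightarrow> 'u \<Rightarrow> 'o" where
  "sort M x = (THE s. s \<in> S \<and> edge M (idt K s) x x)"

definition order :: "'u struct \<Rightarrow> 'u rel" where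
  "order M = {(x, y). \<exists>f\<in>arrs. edge M f x y}"

definition diagram :: "'u struct \<Rightarrow> ('u, 'u \<times> 'u, 'o, 'm) fnctr" where
  "diagram M = \<lparr>omap = sort M, amap = (\<lambda>(x, y). THE f. f \<in> arrs \<and> edge M f x y)\<rparr>"

abbreviation shape :: "'u struct \<Rightarrow> ('u, 'u \<times> 'u) cat" where
  "shape M \<equiv> poset_cat (carrier M) (order M)"

lemma omap_diagram [simp]: "omap (diagram M) = sort M"
  by (simp add: diagram_def)

context
  fixes M :: "'u struct"
  assumes M: "M \<in> diagrams"
begin

lemma diagram_axioms_diagrams:
  "x \<in> carrier M \<Longrightarrow> y \<in> carrier M \<Longrightarrow> z \<in> carrier M \<Longrightarrow> diagram_axioms M x y z"
  using M by (simp add: diagrams_def)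

lemma edge_sort_exists: "x \<in> carrier M \<Longrightarrow> \<exists>s\<in>S. edge M (idt K s) x x"
  using diagram_axioms_diagrams by (simp add: diagram_axioms_def)

lemma edge_cmp:
  assumes "f \<in> arrs" "g \<in> arrs" "edge M f x y" "edge M g y z"
  shows "trg K f = src K g" "edge M (cmp K g f) x z"
  using diagram_axioms_diagrams[of x y z] edge_carrier[OF diagrams_struct[OF M]] assms
  by (simp_all add: diagram_axioms_def)

lemma edge_unique:
  assumes "f \<in> arrs" "g \<in> arrs" "edge M f x y" "edge M g x y"
  shows "f = g"
  using diagram_axioms_diagrams[of x y x] edge_carrier[OF diagrams_struct[OF M]] assms
  by (simp add: diagram_axioms_def)

lemma edge_antisym:
  assumes "f \<in> arrs" "g \<in> arrs" "edge M f x y" "edge M g y x"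
  shows "x = y"
  using diagram_axioms_diagrams[of x y x] edge_carrier[OF diagrams_struct[OF M]] assms
  unfolding diagram_axioms_def by blast

lemma edge_separated:
  assumes "f \<in> arrs" "edge M f x z" "edge M f y z"
  shows "x = y"
  using diagram_axioms_diagrams[of x y z] edge_carrier[OF diagrams_struct[OF M]] assms
  unfolding diagram_axioms_def by blast

lemma sort_eq:
  assumes s: "s \<in> S" "edge M (idt K s) x x"
  shows "sort M x = s"
  unfolding sort_def
proof (rule the_equality)
  fix s' assume s': "s' \<in> S \<and> edge M (idt K s') x x"
  then have "idt K s' = idt K s" using edge_unique[OF idt_arrs idt_arrs] s by blast
  moreover have "idt K s' \<in> hom K s' s'" "idt K s \<in> hom K s s" using s s' S_Obj idt_hom by blast+
  ultimately show "s' = s" by (simp add: hom_def)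
qed (use s in simp)

lemma sort_edge:
  assumes "x \<in> carrier M"
  shows "sort M x \<in> S" "edge M (idt K (sort M x)) x x"
  using edge_sort_exists[OF assms] sort_eq by auto

lemma edge_hom:
  assumes f: "f \<in> arrs" "edge M f x y"
  shows "f \<in> hom K (sort M x) (sort M y)"
proof -
  note xy = edge_carrier[OF diagrams_struct[OF M] f]
  note x = sort_edge[OF xy(1)] and y = sort_edge[OF xy(2)]
  have "trg K (idt K (sort M x)) = src K f" by (rule edge_cmp(1)[OF idt_arrs[OF x(1)] f(1) x(2) f(2)])
  moreover have "trg K f = src K (idt K (sort M y))"
    by (rule edge_cmp(1)[OF f(1) idt_arrs[OF y(1)] f(2) y(2)])
  moreover have "idt K (sort M x) \<in> hom K (sort M x) (sort M x)"
      "idt K (sort M y) \<in> hom K (sort M y) (sort M y)"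
    using x(1) y(1) S_Obj idt_hom by blast+
  ultimately show ?thesis using arrs_hom[OF f(1)] by (simp add: hom_def)
qed

lemma amap_diagram:
  assumes f: "f \<in> arrs" "edge M f x y"
  shows "amap (diagram M) (x, y) = f"
proof -
  have "(THE f. f \<in> arrs \<and> edge M f x y) = f"
    by (rule the_equality) (use f edge_unique in auto)
  then show ?thesis by (simp add: diagram_def)
qed

lemma orderE:
  assumes "(x, y) \<in> order M"
  obtains f where "f \<in> arrs" "edge M f x y" "amap (diagram M) (x, y) = f"
    "f \<in> hom K (sort M x) (sort M y)"
  using assms amap_diagram edge_hom unfolding order_def by blast

lemma partial_order_on_order: "partial_order_on (carrier M) (order M)"
  unfolding order_on_defs
proof (intro conjI)
  show "order M \<subseteq> carrier M \<times> carrier M"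
    unfolding order_def using edge_carrier[OF diagrams_struct[OF M]] by blast
  show "refl_on (carrier M) (order M)"
    unfolding refl_on_def order_def using sort_edge idt_arrs by blast
  show "trans (order M)"
  proof (rule transI)
    fix x y z assume xy: "(x, y) \<in> order M" and yz: "(y, z) \<in> order M"
    obtain f where f: "f \<in> arrs" "edge M f x y" using orderE[OF xy] by blast
    obtain g where g: "g \<in> arrs" "edge M g y z" using orderE[OF yz] by blast
    show "(x, z) \<in> order M"
      using edge_cmp[OF f(1) g(1) f(2) g(2)] cmp_arrs[OF f(1) g(1)] by (auto simp: order_def)
  qed
  show "antisym (order M)"
    unfolding antisym_def order_def using edge_antisym by blast
qed

lemma directed_poset_order: "directed_poset \<nu> (carrier M) (order M)"
  unfolding directed_poset_def
proof (intro conjI allI impI)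
  show "small TYPE('u) (carrier M)" using struct_small[OF diagrams_struct[OF M]] .
  show "partial_order_on (carrier M) (order M)" by (rule partial_order_on_order)
  fix X assume X: "X \<subseteq> carrier M" "|X| <o \<nu>"
  have "Well_order \<nu>"
    using regular_cardinal_Card_order[OF regular] by (rule card_order_on_well_order_on)
  then obtain \<alpha> g where \<alpha>: "\<alpha> \<in> Field \<nu>" and g: "bij_betw g (underS \<nu> \<alpha>) X"
    using ordLess_bij_betw_underS[OF _ X(2)] by blast
  define t where "t = restrict g (underS \<nu> \<alpha>)"
  have t: "t \<in> underS \<nu> \<alpha> \<rightarrow>\<^sub>E carrier M"
    unfolding t_def using g X(1) by (auto simp: bij_betw_def)
  have "chooses_bound M \<alpha> t" using M \<alpha> t by (simp add: diagrams_def)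
  then have "(x, fun_interp M \<alpha> t) \<in> order M" if "x \<in> X" for x
    using that g unfolding chooses_bound_def order_def t_def by (auto simp: bij_betw_def)
  moreover have "fun_interp M \<alpha> t \<in> carrier M"
    using fun_interp_carrier[OF diagrams_struct[OF M]] \<alpha> t by simp
  ultimately show "\<exists>b\<in>carrier M. \<forall>x\<in>X. (x, b) \<in> order M" by blast
qed

lemma is_functor_diagram: "is_functor (shape M) K (diagram M)"
  unfolding is_functor_poset_cat
proof (intro conjI ballI allI impI)
  show "category (shape M)" using category_poset_cat[OF partial_order_on_order] .
  show "category K" by unfold_locales
  show "omap (diagram M) x \<in> Obj K" if "x \<in> carrier M" for x
    using sort_edge(1)[OF that] S_Obj by auto
  show "case p of (x, y) \<Rightarrow> amap (diagram M) (x, y) \<in> hom K (omap (diagram M) x) (omap (diagram M) y)"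
    if "p \<in> order M" for p
    using that by (cases p) (auto elim: orderE)
  show "amap (diagram M) (x, x) = idt K (omap (diagram M) x)" if "x \<in> carrier M" for x
    using amap_diagram[OF idt_arrs] sort_edge[OF that] by simp
next
  fix x y z assume xy: "(x, y) \<in> order M" and yz: "(y, z) \<in> order M"
  obtain f where f: "f \<in> arrs" "edge M f x y" "amap (diagram M) (x, y) = f"
    using orderE[OF xy] by metis
  obtain g where g: "g \<in> arrs" "edge M g y z" "amap (diagram M) (y, z) = g"
    using orderE[OF yz] by metis
  have "trg K f = src K g" "edge M (cmp K g f) x z" using edge_cmp[OF f(1) g(1) f(2) g(2)] .
  then show "amap (diagram M) (x, z) = cmp K (amap (diagram M) (y, z)) (amap (diagram M) (x, y))"
    using amap_diagram[OF cmp_arrs[OF f(1) g(1)]] f(3) g(3) by simp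
qed

lemma is_cocone_diagram_iff:
  "is_cocone (shape M) K (diagram M) Y d \<longleftrightarrow> Y \<in> Obj K \<and>
    (\<forall>x\<in>carrier M. d x \<in> hom K (sort M x) Y) \<and>
    (\<forall>f\<in>arrs. \<forall>x y. edge M f x y \<longrightarrow> cmp K (d y) f = d x)"
proof -
  have "(\<forall>(x, y)\<in>order M. cmp K (d y) (amap (diagram M) (x, y)) = d x) \<longleftrightarrow>
      (\<forall>f\<in>arrs. \<forall>x y. edge M f x y \<longrightarrow> cmp K (d y) f = d x)"
    using amap_diagram by (fastforce simp: order_def)
  then show ?thesis unfolding is_cocone_poset_cat by simp
qed

end

lemma sort_embedding:
  assumes "M \<in> diagrams" "N \<in> diagrams" "embedding voc h M N" "x \<in> carrier M"
  shows "sort N (h x) = sort M x"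
  using sort_edge[OF assms(1,4)] edge_embedding[OF assms(3) _ assms(4,4)] idt_arrs
  by (intro sort_eq[OF assms(2)]) auto


subsection \<open>The structure of a separated diagram\<close>

definition encode :: "'u set \<Rightarrow> 'u rel \<Rightarrow> ('u, 'u \<times> 'u, 'o, 'm) fnctr \<Rightarrow> 'u struct" where
  "encode I r G = \<lparr>carrier = I,
    fun_interp = (\<lambda>\<alpha>\<in>Field \<nu>. \<lambda>t \<in> underS \<nu> \<alpha> \<rightarrow>\<^sub>E I.
      SOME b. b \<in> I \<and> (\<forall>z \<in> underS \<nu> \<alpha>. (t z, b) \<in> r)),
    rel_interp = (\<lambda>R. {pair i j | i j.
      (i, j) \<in> r \<and> amap G (i, j) \<in> arrs \<and> R = arrow_symbol (amap G (i, j))})\<rparr>"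

lemma carrier_encode [simp]: "carrier (encode I r G) = I"
  by (simp add: encode_def)

lemma edge_encode:
  assumes "f \<in> arrs"
  shows "edge (encode I r G) f i j \<longleftrightarrow> (i, j) \<in> r \<and> amap G (i, j) = f"
  using assms inj_onD[OF inj_arrow_symbol] by (auto simp: edge_def encode_def pair_eq_iff)

lemma fun_interp_encode:
  assumes dir: "directed_poset \<nu> I r" and \<alpha>: "\<alpha> \<in> Field \<nu>" and t: "t \<in> underS \<nu> \<alpha> \<rightarrow>\<^sub>E I"
  shows "fun_interp (encode I r G) \<alpha> t \<in> I"
    "z \<in> underS \<nu> \<alpha> \<Longrightarrow> (t z, fun_interp (encode I r G) \<alpha> t) \<in> r"
proof -
  have tI: "t ` underS \<nu> \<alpha> \<subseteq> I" using PiE_mem[OF t] by blast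
  have small: "|t ` underS \<nu> \<alpha>| <o \<nu>"
    by (rule card_of_image_ordLess[OF card_of_underS[OF regular_cardinal_Card_order[OF regular] \<alpha>]])
  obtain b where "b \<in> I \<and> (\<forall>z \<in> underS \<nu> \<alpha>. (t z, b) \<in> r)"
    using directed_poset_bound[OF dir tI small] by (metis imageI)
  then have "(SOME b. b \<in> I \<and> (\<forall>z \<in> underS \<nu> \<alpha>. (t z, b) \<in> r)) \<in> I \<and>
      (\<forall>z \<in> underS \<nu> \<alpha>. (t z, SOME b. b \<in> I \<and> (\<forall>z \<in> underS \<nu> \<alpha>. (t z, b) \<in> r)) \<in> r)"
    by (rule someI[where P = "\<lambda>b. b \<in> I \<and> (\<forall>z \<in> underS \<nu> \<alpha>. (t z, b) \<in> r)"])
  then show "fun_interp (encode I r G) \<alpha> t \<in> I"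
    "z \<in> underS \<nu> \<alpha> \<Longrightarrow> (t z, fun_interp (encode I r G) \<alpha> t) \<in> r"
    using \<alpha> t by (simp_all add: encode_def)
qed

context
  fixes I :: "'u set" and r :: "'u rel" and G :: "('u, 'u \<times> 'u, 'o, 'm) fnctr"
  assumes dir: "directed_poset \<nu> I r" and G: "is_functor (poset_cat I r) K G"
    and objects: "\<And>i. i \<in> I \<Longrightarrow> omap G i \<in> S" and separated: "separated r G"
begin

lemma amap_arrs: "(i, j) \<in> r \<Longrightarrow> amap G (i, j) \<in> arrs"
  using functor_poset_catD(2,5,6)[OF G] objects hom_arrs by blast

lemma is_struct_encode: "is_struct voc (encode I r G)"
  unfolding is_struct_def
proof (intro conjI ballI allI impI)
  show "small TYPE('u) (carrier (encode I r G))" using directed_poset_small[OF dir] by simp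
  show "fun_interp (encode I r G)
      \<in> (\<Pi>\<^sub>E f\<in>funs voc. (fun_arity voc f \<rightarrow>\<^sub>E carrier (encode I r G)) \<rightarrow>\<^sub>E carrier (encode I r G))"
    using fun_interp_encode(1)[OF dir, of _ _ G] by (simp add: encode_def)
  show "rel_interp (encode I r G) R \<subseteq> rel_arity voc R \<rightarrow>\<^sub>E carrier (encode I r G)" for R
  proof
    fix t assume "t \<in> rel_interp (encode I r G) R"
    then obtain i j where "t = pair i j" "(i, j) \<in> r" by (auto simp: encode_def)
    then show "t \<in> rel_arity voc R \<rightarrow>\<^sub>E carrier (encode I r G)"
      using functor_poset_catD(5,6)[OF G] by (simp add: pair_PiE_iff)
  qed
  show "rel_interp (encode I r G) R = {}" if "R \<notin> rels voc" for R
    using that by (auto simp: encode_def)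
qed

lemma diagram_axioms_encode:
  assumes "x \<in> I"
  shows "diagram_axioms (encode I r G) x y z"
  unfolding diagram_axioms_def
proof (intro conjI ballI impI)
  have "(x, x) \<in> r"
    using partial_order_onD(1)[OF directed_poset_partial_order[OF dir]] assms
    by (simp add: refl_on_def)
  then show "\<exists>s\<in>S. edge (encode I r G) (idt K s) x x"
    using objects[OF assms] functor_poset_catD(3)[OF G assms] edge_encode[OF idt_arrs] by metis
next
  fix f g assume f: "f \<in> arrs" "edge (encode I r G) f x y" and g: "g \<in> arrs" "edge (encode I r G) g y z"
  then have fg: "(x, y) \<in> r" "amap G (x, y) = f" "(y, z) \<in> r" "amap G (y, z) = g"
    by (simp_all add: edge_encode)
  then have "f \<in> hom K (omap G x) (omap G y)" "g \<in> hom K (omap G y) (omap G z)"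
    using functor_poset_catD(2)[OF G] by metis+
  then show trg: "trg K f = src K g" by (simp add: hom_def)
  have "(x, z) \<in> r"
    using partial_order_onD(2)[OF directed_poset_partial_order[OF dir]] fg(1,3) by (rule transD)
  then show "edge (encode I r G) (cmp K g f) x z"
    using functor_poset_catD(4)[OF G fg(1,3)] fg(2,4) edge_encode[OF cmp_arrs[OF f(1) g(1) trg]]
    by simp
next
  fix f g assume "f \<in> arrs" "g \<in> arrs" "edge (encode I r G) f x y" "edge (encode I r G) g y x"
  then have "(x, y) \<in> r" "(y, x) \<in> r" by (simp_all add: edge_encode)
  then show "x = y"
    using partial_order_onD(3)[OF directed_poset_partial_order[OF dir]] by (simp add: antisym_def)
next
  fix f assume "f \<in> arrs" "edge (encode I r G) f x z" "edge (encode I r G) f y z"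
  then show "x = y" using separated unfolding separated_def by (metis edge_encode)
qed (simp add: edge_encode)

lemma encode_diagrams: "encode I r G \<in> diagrams"
proof -
  have "chooses_bound (encode I r G) \<alpha> t" if "\<alpha> \<in> Field \<nu>" "t \<in> underS \<nu> \<alpha> \<rightarrow>\<^sub>E I" for \<alpha> t
    using fun_interp_encode(2)[OF dir that] amap_arrs edge_encode unfolding chooses_bound_def
    by blast
  then show ?thesis using is_struct_encode diagram_axioms_encode by (simp add: diagrams_def)
qed

lemma sort_encode:
  assumes "i \<in> I"
  shows "sort (encode I r G) i = omap G i"
proof (rule sort_eq[OF encode_diagrams objects[OF assms]])
  have "(i, i) \<in> r"
    using partial_order_onD(1)[OF directed_poset_partial_order[OF dir]] assms
    by (simp add: refl_on_def)
  then show "edge (encode I r G) (idt K (omap G i)) i i"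
    using functor_poset_catD(3)[OF G assms] edge_encode[OF idt_arrs[OF objects[OF assms]]] by simp
qed

lemma is_colimit_encode:
  assumes "is_colimit (poset_cat I r) K G X c"
  shows "is_colimit (shape (encode I r G)) K (diagram (encode I r G)) X c"
proof -
  have "is_cocone (shape (encode I r G)) K (diagram (encode I r G)) Y d \<longleftrightarrow>
      is_cocone (poset_cat I r) K G Y d" for Y d
  proof -
    have "(\<forall>f\<in>arrs. \<forall>x y. edge (encode I r G) f x y \<longrightarrow> cmp K (d y) f = d x) \<longleftrightarrow>
        (\<forall>(i, j)\<in>r. cmp K (d j) (amap G (i, j)) = d i)"
      using amap_arrs by (auto simp: edge_encode)
    then show ?thesis
      unfolding is_cocone_diagram_iff[OF encode_diagrams] using sort_encode
      by (simp add: is_cocone_poset_cat)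
  qed
  then show ?thesis using assms by (simp add: is_colimit_def)
qed

end

end


section \<open>The colimit functor\<close>

locale structured_diagram_colimits = structured_diagrams K \<nu> S
  for K :: "('o, 'm) cat" and \<nu> :: "'u rel" and S +
  assumes directed_colimits: "has_directed_colimits \<nu> K"
begin

definition colimit_cocone :: "'u struct \<Rightarrow> 'o \<times> ('u \<Rightarrow> 'm)" where
  "colimit_cocone M = (SOME p. is_colimit (shape M) K (diagram M) (fst p) (snd p))"

abbreviation apex :: "'u struct \<Rightarrow> 'o" where
  "apex M \<equiv> fst (colimit_cocone M)"

abbreviation leg :: "'u struct \<Rightarrow> 'u \<Rightarrow> 'm" where
  "leg M \<equiv> snd (colimit_cocone M)"

definition colim_functor ::
    "('u struct, 'u struct \<times> ('u \<Rightarrow> 'u) \<times> 'u struct, 'o, 'm) fnctr" where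
  "colim_functor = \<lparr>omap = apex,
    amap = (\<lambda>(M, h, N). THE k. k \<in> hom K (apex M) (apex N) \<and>
      (\<forall>x\<in>carrier M. cmp K k (leg M x) = leg N (h x)))\<rparr>"

lemma omap_colim_functor [simp]: "omap colim_functor = apex"
  by (simp add: colim_functor_def)

lemma is_colimit_apex:
  assumes M: "M \<in> diagrams"
  shows "is_colimit (shape M) K (diagram M) (apex M) (leg M)"
proof -
  obtain X c where "is_colimit (shape M) K (diagram M) X c"
    using directed_colimits directed_poset_order[OF M] is_functor_diagram[OF M]
    unfolding has_directed_colimits_def by blast
  then have "is_colimit (shape M) K (diagram M) (fst (X, c)) (snd (X, c))" by simp
  then show ?thesis unfolding colimit_cocone_def
    by (rule someI[where P = "\<lambda>p. is_colimit (shape M) K (diagram M) (fst p) (snd p)"])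
qed

lemma leg_cocone:
  assumes M: "M \<in> diagrams"
  shows "apex M \<in> Obj K" "x \<in> carrier M \<Longrightarrow> leg M x \<in> hom K (sort M x) (apex M)"
    "f \<in> arrs \<Longrightarrow> edge M f x y \<Longrightarrow> cmp K (leg M y) f = leg M x"
  using colimit_is_cocone[OF is_colimit_apex[OF M]] is_cocone_diagram_iff[OF M] by auto

lemma legs_jointly_epic:
  assumes M: "M \<in> diagrams" and "k \<in> hom K (apex M) Y" "k' \<in> hom K (apex M) Y"
    and "\<And>x. x \<in> carrier M \<Longrightarrow> cmp K k (leg M x) = cmp K k' (leg M x)"
  shows "k = k'"
  by (rule colimit_jointly_epic[OF is_functor_diagram[OF M] is_colimit_apex[OF M] assms(2,3)])
    (simp add: assms(4))

lemma amap_colim_functor_eqI: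
  assumes a: "a \<in> hom diagram_cat M N" and k: "k \<in> hom K (apex M) (apex N)"
    and legs: "\<And>x. x \<in> carrier M \<Longrightarrow> cmp K k (leg M x) = leg N (underlying a x)"
  shows "amap colim_functor a = k"
proof -
  have "(THE k. k \<in> hom K (apex M) (apex N) \<and>
      (\<forall>x\<in>carrier M. cmp K k (leg M x) = leg N (underlying a x))) = k"
  proof (rule the_equality)
    show "k' = k" if "k' \<in> hom K (apex M) (apex N) \<and>
        (\<forall>x\<in>carrier M. cmp K k' (leg M x) = leg N (underlying a x))" for k'
      using legs_jointly_epic[OF hom_AEC_catD(1)[OF a] _ k] legs that by simp
  qed (use k legs in simp)
  moreover have "amap colim_functor a = amap colim_functor (M, underlying a, N)"
    using hom_AEC_catD(4)[OF a] by simp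
  ultimately show ?thesis by (simp add: colim_functor_def)
qed

lemma amap_colim_functor:
  assumes a: "a \<in> hom diagram_cat M N"
  shows "amap colim_functor a \<in> hom K (apex M) (apex N)"
    "x \<in> carrier M \<Longrightarrow> cmp K (amap colim_functor a) (leg M x) = leg N (underlying a x)"
proof -
  note M = hom_AEC_catD(1)[OF a] and N = hom_AEC_catD(2)[OF a] and h = hom_AEC_catD(3)[OF a]
  have "is_cocone (shape M) K (diagram M) (apex N) (\<lambda>x. leg N (underlying a x))"
    unfolding is_cocone_diagram_iff[OF M]
  proof (intro conjI ballI allI impI)
    show "apex N \<in> Obj K" using leg_cocone(1)[OF N] .
    show "leg N (underlying a x) \<in> hom K (sort M x) (apex N)" if "x \<in> carrier M" for x
      using leg_cocone(2)[OF N underlying_carrier[OF a that]] sort_embedding[OF M N h that] by simp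
    show "cmp K (leg N (underlying a y)) f = leg N (underlying a x)"
      if f: "f \<in> arrs" "edge M f x y" for f x y
      using leg_cocone(3)[OF N f(1)] edge_embedding[OF h f(1)]
        edge_carrier[OF diagrams_struct[OF M] f] f(2) by simp
  qed
  then obtain k where k: "k \<in> hom K (apex M) (apex N)"
      "\<And>x. x \<in> carrier M \<Longrightarrow> cmp K k (leg M x) = leg N (underlying a x)"
    using colimit_poset_cat_factor[OF is_colimit_apex[OF M]] by blast
  have "amap colim_functor a = k" using amap_colim_functor_eqI[OF a k] .
  then show "amap colim_functor a \<in> hom K (apex M) (apex N)"
    "x \<in> carrier M \<Longrightarrow> cmp K (amap colim_functor a) (leg M x) = leg N (underlying a x)"
    using k by simp_all
qed

lemma cmp_amap_colim_functor_leg: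
  assumes a: "a \<in> hom diagram_cat M N" and k: "k \<in> hom K (apex N) Y" and x: "x \<in> carrier M"
  shows "cmp K (cmp K k (amap colim_functor a)) (leg M x) = cmp K k (leg N (underlying a x))"
  using cmp_assoc[OF leg_cocone(2)[OF hom_AEC_catD(1)[OF a] x] amap_colim_functor(1)[OF a] k]
    amap_colim_functor(2)[OF a x] by simp

lemma is_functor_colim_functor: "is_functor diagram_cat K colim_functor"
proof -
  interpret A: category diagram_cat by (rule category_AEC_cat) (rule diagrams_struct)
  show ?thesis
  proof
    show "omap colim_functor M \<in> Obj K" if "M \<in> Obj diagram_cat" for M
      using that leg_cocone(1) by simp
    show "amap colim_functor a \<in> hom K (omap colim_functor M) (omap colim_functor N)"
      if "a \<in> hom diagram_cat M N" for a M N
      using amap_colim_functor(1)[OF that] by simp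
    show "amap colim_functor (idt diagram_cat M) = idt K (omap colim_functor M)"
      if "M \<in> Obj diagram_cat" for M
    proof (rule amap_colim_functor_eqI[OF A.idt_hom[OF that]])
      have M: "M \<in> diagrams" using that by simp
      show "idt K (omap colim_functor M) \<in> hom K (apex M) (apex M)"
        using idt_hom[OF leg_cocone(1)[OF M]] by simp
      show "cmp K (idt K (omap colim_functor M)) (leg M x) = leg M (underlying (idt diagram_cat M) x)"
        if "x \<in> carrier M" for x
        using cmp_idt_left[OF leg_cocone(2)[OF M that]] that by simp
    qed
    show "amap colim_functor (cmp diagram_cat b a) = cmp K (amap colim_functor b) (amap colim_functor a)"
      if a: "a \<in> hom diagram_cat M N" and b: "b \<in> hom diagram_cat N P" for a b M N P
    proof (rule amap_colim_functor_eqI[OF A.cmp_hom[OF a b]])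
      show "cmp K (amap colim_functor b) (amap colim_functor a) \<in> hom K (apex M) (apex P)"
        using cmp_hom[OF amap_colim_functor(1)[OF a] amap_colim_functor(1)[OF b]] .
      show "cmp K (cmp K (amap colim_functor b) (amap colim_functor a)) (leg M x)
          = leg P (underlying (cmp diagram_cat b a) x)" if x: "x \<in> carrier M" for x
        using cmp_amap_colim_functor_leg[OF a amap_colim_functor(1)[OF b] x]
          amap_colim_functor(2)[OF b underlying_carrier[OF a x]] underlying_cmp[OF a b x] by simp
    qed
  qed
qed


subsection \<open>Faithfulness\<close>

lemma leg_inj:
  assumes monic: "\<forall>f\<in>Arr K. monomorphism K f" and M: "M \<in> diagrams"
    and xy: "x \<in> carrier M" "y \<in> carrier M" "sort M x = sort M y" and eq: "leg M x = leg M y"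
  shows "x = y"
proof -
  obtain z where z: "z \<in> carrier M" "(x, z) \<in> order M" "(y, z) \<in> order M"
    using directed_poset_bound_pair[OF regular directed_poset_order[OF M] xy(1,2)] by metis
  obtain f where f: "f \<in> arrs" "edge M f x z" "f \<in> hom K (sort M x) (sort M z)"
    using orderE[OF M z(2)] by metis
  obtain g where g: "g \<in> arrs" "edge M g y z" "g \<in> hom K (sort M y) (sort M z)"
    using orderE[OF M z(3)] by metis
  have "leg M z \<in> hom K (sort M z) (apex M)" using leg_cocone(2)[OF M z(1)] .
  moreover have "monomorphism K (leg M z)" using monic calculation by (simp add: hom_def)
  moreover have "cmp K (leg M z) f = cmp K (leg M z) g"
    using leg_cocone(3)[OF M f(1,2)] leg_cocone(3)[OF M g(1,2)] eq by simp
  ultimately have "f = g" using monic_cancel[of "leg M z"] f(3) g(3) xy(3) by metis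
  then show "x = y" using edge_separated[OF M f(1,2)] g(2) by simp
qed

lemma faithful_colim_functor:
  assumes "\<forall>f\<in>Arr K. monomorphism K f"
  shows "faithful diagram_cat colim_functor"
  unfolding faithful_def
proof (intro ballI inj_onI)
  fix M N a b
  assume a: "a \<in> hom diagram_cat M N" and b: "b \<in> hom diagram_cat M N"
    and eq: "amap colim_functor a = amap colim_functor b"
  note M = hom_AEC_catD(1)[OF a] and N = hom_AEC_catD(2)[OF a]
  show "a = b"
  proof (rule hom_AEC_cat_eqI[OF a b])
    fix x assume x: "x \<in> carrier M"
    show "underlying a x = underlying b x"
    proof (rule leg_inj[OF assms N underlying_carrier[OF a x] underlying_carrier[OF b x]])
      show "sort N (underlying a x) = sort N (underlying b x)"
        using sort_embedding[OF M N hom_AEC_catD(3)[OF a] x]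
          sort_embedding[OF M N hom_AEC_catD(3)[OF b] x] by simp
      show "leg N (underlying a x) = leg N (underlying b x)"
        using amap_colim_functor(2)[OF a x] amap_colim_functor(2)[OF b x] eq by simp
    qed
  qed
qed


subsection \<open>Preservation of directed colimits\<close>

context
  fixes I :: "'u set" and r :: "'u rel"
    and G :: "('u, 'u \<times> 'u, 'u struct, 'u struct \<times> ('u \<Rightarrow> 'u) \<times> 'u struct) fnctr"
    and X :: "'u struct" and c :: "'u \<Rightarrow> 'u struct \<times> ('u \<Rightarrow> 'u) \<times> 'u struct"
  assumes dir: "directed_poset \<nu> I r" and G: "is_functor (poset_cat I r) diagram_cat G"
    and cocone: "is_cocone (poset_cat I r) diagram_cat G X c"
    and surj: "carrier X \<subseteq> (\<Union>i\<in>I. underlying (c i) ` carrier (omap G i))"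
begin

lemma vertex_diagrams: "X \<in> diagrams"
  using cocone_poset_catD(1)[OF cocone] by simp

lemma object_diagrams: "i \<in> I \<Longrightarrow> omap G i \<in> diagrams"
  using functor_poset_catD(1)[OF G] by simp

lemma edge_lift:
  assumes f: "f \<in> arrs" "edge X f x y"
  obtains k u v where "k \<in> I" "u \<in> carrier (omap G k)" "v \<in> carrier (omap G k)"
    "underlying (c k) u = x" "underlying (c k) v = y" "edge (omap G k) f u v"
proof -
  have sub: "{x, y} \<subseteq> (\<Union>i\<in>I. underlying (c i) ` carrier (omap G i))"
    using surj edge_carrier[OF diagrams_struct[OF vertex_diagrams] f] by blast
  have small: "|{x, y}| <o \<nu>" by (rule finite_ordLess_regular_cardinal[OF regular]) simp
  obtain k where k: "k \<in> I" and xy: "{x, y} \<subseteq> underlying (c k) ` carrier (omap G k)"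
    by (rule directed_UN_subset[where B = "\<lambda>i. underlying (c i) ` carrier (omap G i)",
          OF dir AEC_cocone_image_mono[OF G cocone] sub small])
  obtain u v where uv: "u \<in> carrier (omap G k)" "v \<in> carrier (omap G k)"
      "underlying (c k) u = x" "underlying (c k) v = y"
    using xy by auto
  have "edge (omap G k) f u v"
    using edge_embedding[OF hom_AEC_catD(3)[OF cocone_poset_catD(2)[OF cocone k]] f(1) uv(1,2)]
      f(2) uv(3,4) by simp
  then show ?thesis by (rule that[OF k uv])
qed

lemma colim_functor_cocone_push:
  assumes d: "is_cocone (poset_cat I r) K (functor_comp colim_functor G) Y d"
    and ij: "(i, j) \<in> r" and x: "x \<in> carrier (omap G i)"
  shows "cmp K (d j) (leg (omap G j) (underlying (amap G (i, j)) x)) = cmp K (d i) (leg (omap G i) x)"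
proof -
  have dj: "d j \<in> hom K (apex (omap G j)) Y"
    using cocone_poset_catD(2)[OF d functor_poset_catD(6)[OF G ij]] by (simp add: functor_comp_def)
  have "cmp K (d j) (amap colim_functor (amap G (i, j))) = d i"
    using cocone_poset_catD(3)[OF d ij] by (simp add: functor_comp_def)
  then show ?thesis using cmp_amap_colim_functor_leg[OF functor_poset_catD(2)[OF G ij] dj x] by simp
qed

lemma colim_functor_cocone_coherent:
  assumes d: "is_cocone (poset_cat I r) K (functor_comp colim_functor G) Y d"
    and ij: "i \<in> I" "j \<in> I" and xy: "x \<in> carrier (omap G i)" "y \<in> carrier (omap G j)"
    and eq: "underlying (c i) x = underlying (c j) y"
  shows "cmp K (d i) (leg (omap G i) x) = cmp K (d j) (leg (omap G j) y)"
proof -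
  obtain k where k: "k \<in> I" "(i, k) \<in> r" "(j, k) \<in> r"
    using directed_poset_bound_pair[OF regular dir ij] by metis
  let ?x = "underlying (amap G (i, k)) x" and ?y = "underlying (amap G (j, k)) y"
  have "inj_on (underlying (c k)) (carrier (omap G k))"
    using embeddingD(4)[OF hom_AEC_catD(3)[OF cocone_poset_catD(2)[OF cocone k(1)]]] .
  moreover have "underlying (c k) ?x = underlying (c k) ?y"
    using AEC_cocone_apply[OF G cocone k(2) xy(1)] AEC_cocone_apply[OF G cocone k(3) xy(2)] eq
    by simp
  moreover have "?x \<in> carrier (omap G k)" "?y \<in> carrier (omap G k)"
    using underlying_carrier[OF functor_poset_catD(2)[OF G k(2)] xy(1)]
      underlying_carrier[OF functor_poset_catD(2)[OF G k(3)] xy(2)] .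
  ultimately have "?x = ?y" by (rule inj_onD)
  then show ?thesis
    using colim_functor_cocone_push[OF d k(2) xy(1)] colim_functor_cocone_push[OF d k(3) xy(2)]
    by simp
qed

lemma colim_functor_cocone_glue:
  assumes d: "is_cocone (poset_cat I r) K (functor_comp colim_functor G) Y d"
  obtains m where "is_cocone (shape X) K (diagram X) Y m"
    "\<And>i x. i \<in> I \<Longrightarrow> x \<in> carrier (omap G i) \<Longrightarrow>
      m (underlying (c i) x) = cmp K (d i) (leg (omap G i) x)"
proof -
  have dI: "d i \<in> hom K (apex (omap G i)) Y" if "i \<in> I" for i
    using cocone_poset_catD(2)[OF d that] by (simp add: functor_comp_def)
  have cI: "c i \<in> hom diagram_cat (omap G i) X" if "i \<in> I" for i
    using cocone_poset_catD(2)[OF cocone that] .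
  have "\<forall>y\<in>carrier X. \<exists>i x. i \<in> I \<and> x \<in> carrier (omap G i) \<and> underlying (c i) x = y"
    using surj by blast
  then obtain \<iota> \<xi> where lift: "\<And>y. y \<in> carrier X \<Longrightarrow>
      \<iota> y \<in> I \<and> \<xi> y \<in> carrier (omap G (\<iota> y)) \<and> underlying (c (\<iota> y)) (\<xi> y) = y"
    by metis
  define m where "m y = cmp K (d (\<iota> y)) (leg (omap G (\<iota> y)) (\<xi> y))" for y
  have m: "m (underlying (c i) x) = cmp K (d i) (leg (omap G i) x)"
    if i: "i \<in> I" and x: "x \<in> carrier (omap G i)" for i x
    using lift[OF underlying_carrier[OF cI[OF i] x]] i x unfolding m_def
    by (intro colim_functor_cocone_coherent[OF d]) auto
  have "is_cocone (shape X) K (diagram X) Y m"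
    unfolding is_cocone_diagram_iff[OF vertex_diagrams]
  proof (intro conjI ballI allI impI)
    show "Y \<in> Obj K" using cocone_poset_catD(1)[OF d] .
    show "m y \<in> hom K (sort X y) Y" if y: "y \<in> carrier X" for y
    proof -
      note i = lift[OF y, THEN conjunct1] and x = lift[OF y, THEN conjunct2, THEN conjunct1]
      have "sort (omap G (\<iota> y)) (\<xi> y) = sort X y"
        using sort_embedding[OF object_diagrams[OF i] vertex_diagrams hom_AEC_catD(3)[OF cI[OF i]] x]
          lift[OF y] by simp
      then show ?thesis
        using cmp_hom[OF leg_cocone(2)[OF object_diagrams[OF i] x] dI[OF i]] by (simp add: m_def)
    qed
    fix f x y assume f: "f \<in> arrs" "edge X f x y"
    obtain k u v where k: "k \<in> I" and uv: "u \<in> carrier (omap G k)" "v \<in> carrier (omap G k)"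
        "underlying (c k) u = x" "underlying (c k) v = y" and edge: "edge (omap G k) f u v"
      using edge_lift[OF f] by metis
    note Gk = object_diagrams[OF k]
    show "cmp K (m y) f = m x"
      using m[OF k uv(1)] m[OF k uv(2)] uv(3,4) leg_cocone(3)[OF Gk f(1) edge]
        cmp_assoc[OF edge_hom[OF Gk f(1) edge] leg_cocone(2)[OF Gk uv(2)] dI[OF k]]
      by simp
  qed
  then show ?thesis using m that by blast
qed

lemma is_colimit_colim_functor:
  "is_colimit (poset_cat I r) K (functor_comp colim_functor G) (apex X) (\<lambda>i. amap colim_functor (c i))"
proof (rule is_colimit_poset_catI)
  let ?F = colim_functor
  have c: "c i \<in> hom diagram_cat (omap G i) X" if "i \<in> I" for i
    using cocone_poset_catD(2)[OF cocone that] .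
  show "is_cocone (poset_cat I r) K (functor_comp ?F G) (apex X) (\<lambda>i. amap ?F (c i))"
    using is_cocone_functor_comp[OF is_functor_colim_functor G cocone] by simp
  show "\<exists>h\<in>hom K (apex X) Y. \<forall>i\<in>I. cmp K h (amap ?F (c i)) = d i"
    if d: "is_cocone (poset_cat I r) K (functor_comp ?F G) Y d" for Y d
  proof -
    obtain m where m: "is_cocone (shape X) K (diagram X) Y m"
      "\<And>i x. i \<in> I \<Longrightarrow> x \<in> carrier (omap G i) \<Longrightarrow>
        m (underlying (c i) x) = cmp K (d i) (leg (omap G i) x)"
      using colim_functor_cocone_glue[OF d] by metis
    obtain h where h: "h \<in> hom K (apex X) Y" "\<And>x. x \<in> carrier X \<Longrightarrow> cmp K h (leg X x) = m x"
      using colimit_poset_cat_factor[OF is_colimit_apex[OF vertex_diagrams] m(1)] by blast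
    have "cmp K h (amap ?F (c i)) = d i" if i: "i \<in> I" for i
    proof (rule legs_jointly_epic[OF object_diagrams[OF i]])
      show "cmp K h (amap ?F (c i)) \<in> hom K (apex (omap G i)) Y"
        using cmp_hom[OF amap_colim_functor(1)[OF c[OF i]] h(1)] .
      show "d i \<in> hom K (apex (omap G i)) Y"
        using cocone_poset_catD(2)[OF d i] by (simp add: functor_comp_def)
      show "cmp K (cmp K h (amap ?F (c i))) (leg (omap G i) x) = cmp K (d i) (leg (omap G i) x)"
        if "x \<in> carrier (omap G i)" for x
        using cmp_amap_colim_functor_leg[OF c[OF i] h(1) that] m(2)[OF i that]
          h(2)[OF underlying_carrier[OF c[OF i] that]] by simp
    qed
    then show ?thesis using h(1) by blast
  qed
  show "h = h'" if h: "h \<in> hom K (apex X) Y" "h' \<in> hom K (apex X) Y"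
    and eq: "\<And>i. i \<in> I \<Longrightarrow> cmp K h (amap ?F (c i)) = cmp K h' (amap ?F (c i))" for Y h h'
  proof (rule legs_jointly_epic[OF vertex_diagrams h])
    fix y assume "y \<in> carrier X"
    then obtain i x where i: "i \<in> I" and x: "x \<in> carrier (omap G i)" "y = underlying (c i) x"
      using surj by blast
    show "cmp K h (leg X y) = cmp K h' (leg X y)"
      using cmp_amap_colim_functor_leg[OF c[OF i] h(1) x(1)]
        cmp_amap_colim_functor_leg[OF c[OF i] h(2) x(1)] eq[OF i] x(2) by simp
  qed
qed

end

lemma preserves_colim_functor: "preserves_directed_colimits \<nu> diagram_cat K colim_functor"
  unfolding preserves_directed_colimits_def
proof (intro allI impI)
  fix I r G X c
  assume dir: "directed_poset \<nu> I r" and G: "is_functor (poset_cat I r) diagram_cat G"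
    and colim: "is_colimit (poset_cat I r) diagram_cat G X c"
  have "carrier X \<subseteq> (\<Union>i\<in>I. underlying (c i) ` carrier (omap G i))"
    using AEC_colimit_jointly_surjective[OF universal_AEC_diagrams dir G colim] by simp
  then show "is_colimit (poset_cat I r) K (functor_comp colim_functor G) (omap colim_functor X)
      (\<lambda>i. amap colim_functor (c i))"
    using is_colimit_colim_functor[OF dir G colimit_is_cocone[OF colim]] by simp
qed


subsection \<open>Essential surjectivity\<close>

lemma essentially_surjective_colim_functor:
  assumes monic: "\<forall>f\<in>Arr K. monomorphism K f"
    and generated: "\<And>X. X \<in> Obj K \<Longrightarrow> directed_colimit_of \<nu> K S X"
  shows "essentially_surjective diagram_cat K colim_functor"
  unfolding essentially_surjective_def
proof (intro ballI)
  fix X assume "X \<in> Obj K"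
  then obtain I r G c where dir: "directed_poset \<nu> I r" and G: "is_functor (poset_cat I r) K G"
    and objects: "\<forall>i\<in>I. omap G i \<in> S" and colim: "is_colimit (poset_cat I r) K G X c"
    using generated unfolding directed_colimit_of_def by blast
  obtain J q H where J: "J \<subseteq> I" "directed_poset \<nu> J q" and H: "is_functor (poset_cat J q) K H"
      "separated q H" "\<And>j. j \<in> J \<Longrightarrow> omap H j = omap G j" "is_colimit (poset_cat J q) K H X c"
    using directed_colimit_separated[OF regular monic dir G colim] by metis
  have HS: "omap H j \<in> S" if "j \<in> J" for j using H(3)[OF that] objects J(1) that by auto
  have M: "encode J q H \<in> diagrams" by (rule encode_diagrams[OF J(2) H(1) HS H(2)])
  have "is_colimit (shape (encode J q H)) K (diagram (encode J q H)) X c"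
    by (rule is_colimit_encode[OF J(2) H(1) HS H(2,4)])
  then have "isomorphic K (apex (encode J q H)) X"
    by (rule colimit_unique[OF is_functor_diagram[OF M] is_colimit_apex[OF M]])
  then show "\<exists>M\<in>Obj diagram_cat. isomorphic K (omap colim_functor M) X" using M by auto
qed

end


section \<open>Accessible categories\<close>

lemma preserves_directed_colimits_mono:
  fixes \<mu> \<nu> :: "'u rel"
  assumes "preserves_directed_colimits \<nu> C D F" "\<nu> \<le>o \<mu>"
  shows "preserves_directed_colimits \<mu> C D F"
  using assms(1) directed_poset_mono[OF _ assms(2)]
  unfolding preserves_directed_colimits_def by blast

lemma directed_colimit_of_mono:
  fixes \<mu> \<nu> :: "'u rel"
  assumes "directed_colimit_of \<mu> C S X" "\<nu> \<le>o \<mu>"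
  shows "directed_colimit_of \<nu> C S X"
  using assms(1) directed_poset_mono[OF _ assms(2)]
  unfolding directed_colimit_of_def by blast

lemma accessible_generated_below:
  fixes \<mu> :: "'u rel" and C :: "('o, 'm) cat"
  assumes \<mu>: "regular_cardinal \<mu>" "has_directed_colimits \<mu> C" and acc: "accessible TYPE('u) C"
  obtains \<nu> :: "'u rel" and S where "\<nu> \<le>o \<mu>" "regular_cardinal \<nu>" "has_directed_colimits \<nu> C"
    "small TYPE('u) S" "S \<subseteq> Obj C" "\<And>X. X \<in> Obj C \<Longrightarrow> directed_colimit_of \<nu> C S X"
proof -
  obtain \<kappa> :: "'u rel" and S where \<kappa>: "regular_cardinal \<kappa>" "has_directed_colimits \<kappa> C"
    and S: "small TYPE('u) S" "\<forall>X\<in>S. presentable \<kappa> C X"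
      "\<And>X. X \<in> Obj C \<Longrightarrow> directed_colimit_of \<kappa> C S X"
    using acc unfolding accessible_def accessible_at_def by blast
  have S_Obj: "S \<subseteq> Obj C" using S(2) unfolding presentable_def by blast
  have wo: "Well_order \<kappa>" "Well_order \<mu>"
    using regular_cardinal_Card_order \<kappa>(1) \<mu>(1) card_order_on_well_order_on by blast+
  show ?thesis
  proof (cases "\<kappa> \<le>o \<mu>")
    case True
    then show ?thesis using that[OF _ \<kappa> S(1) S_Obj S(3)] by blast
  next
    case False
    then have \<mu>\<kappa>: "\<mu> \<le>o \<kappa>" using ordLeq_total[OF wo] by blast
    show ?thesis
      using that[OF ordLeq_reflexive[OF wo(2)] \<mu> S(1) S_Obj directed_colimit_of_mono[OF S(3) \<mu>\<kappa>]] .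
  qed
qed

theorem theorem6p3:
  fixes \<mu> :: "'u rel" and K :: "('o, 'm) cat"
  assumes "regular_universe TYPE('u)"
    and "regular_cardinal \<mu>"
    and "accessible TYPE('u) K"
    and "has_directed_colimits \<mu> K"
    and "\<forall>f \<in> Arr K. monomorphism K f"
  shows "\<exists>(\<tau> :: 'u vocabulary) (L :: 'u struct set)
      (F :: ('u struct, 'u struct \<times> ('u \<Rightarrow> 'u) \<times> 'u struct, 'o, 'm) fnctr).
    universal_AEC \<mu> \<tau> L \<and>
    is_functor (AEC_cat \<tau> L) K F \<and>
    essentially_surjective (AEC_cat \<tau> L) K F \<and>
    faithful (AEC_cat \<tau> L) F \<and>
    preserves_directed_colimits \<mu> (AEC_cat \<tau> L) K F"
proof -
  obtain \<nu> :: "'u rel" and S where \<nu>: "\<nu> \<le>o \<mu>" "regular_cardinal \<nu>" "has_directed_colimits \<nu> K"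
    and S: "small TYPE('u) S" "S \<subseteq> Obj K" "\<And>X. X \<in> Obj K \<Longrightarrow> directed_colimit_of \<nu> K S X"
    using accessible_generated_below[OF assms(2,4,3)] by metis
  have "category K" "locally_small TYPE('u) K"
    using assms(3) unfolding accessible_def accessible_at_def by blast+
  then interpret structured_diagram_colimits K \<nu> S
    using assms(1) \<nu>(2,3) S(1,2)
    by (intro structured_diagram_colimits.intro structured_diagrams.intro
        structured_diagrams_axioms.intro structured_diagram_colimits_axioms.intro)
  have "universal_AEC \<mu> voc diagrams"
    by (rule universal_AEC_mono[OF universal_AEC_diagrams \<nu>(1)])
  moreover have "essentially_surjective diagram_cat K colim_functor"
    by (rule essentially_surjective_colim_functor[OF assms(5) S(3)])
  moreover have "preserves_directed_colimits \<mu> diagram_cat K colim_functor"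
    by (rule preserves_directed_colimits_mono[OF preserves_colim_functor \<nu>(1)])
  ultimately show ?thesis
    using is_functor_colim_functor faithful_colim_functor[OF assms(5)] by blast
qed

end
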